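(* Consider the distributed online problem, network and algorithm described in the context. Suppose: (1) $\mathbb{X}\subseteq\mathbb{R}^p$ is convex and closed, and $\|x\|\le R(\mathbb{X})$ for all $x\in\mathbb{X}$. (2) For all $i\in[n]$, $t\in\mathbb{N}_+$ and $x\in\mathbb{X}$, the subgradients $\nabla f_{i,t}(x)$ and $\nabla g_{i,t}(x)$ exist, and there are constants $G_1,G_2$ with $\|\nabla f_{i,t}(x)\|\le G_1$ and $\|\nabla g_{i,t}(x)\|\le G_2$ for all such $i,t,x$. (3) There is a constant $L$ such that $\|\nabla f_{i,t}(x)-\nabla f_{i,t}(y)\|\le L\|x-y\|$ for all $x,y\in\mathbb{X}$, $i\in[n]$, $t\in\mathbb{N}_+$. (4) For all $t\in\mathbb{N}_+$: (i) there is a constant $w\in(0,1)$ (independent of $t$) such that $[W_t]_{ij}\ge w$ if $(j,i)\in\mathcal{E}_t$ or $i=j$, and $[W_t]_{ij}=0$ otherwise; (ii) $W_t$ is doubly stochastic; (iii) there is an integer $B>0$ (independent of $t$) such that the directed graph $(\mathcal{V},\cup_{l=0}^{B-1}\mathcal{E}_{t+l})$ is strongly connected. (5) The (possibly random) compressor $\mathcal{C}:\mathbb{R}^p\to\mathbb{R}^p$ satisfies $\mathbf{E}_{\mathcal{C}}[\|\mathcal{C}(x)-x\|_d^2]\le C$ for all $x\in\mathbb{R}^p$, for some norm parameter $d\ge1$ and constant $C\ge0$. Let $\{x_{i,t}\}$ be the sequences generated by the algorithm with $$\alpha_t=\alpha_0\sqrt{\frac{\Psi_t}{t}},\qquad \gamma_t=\frac{\gamma_0}{\alpha_t},\qquad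 s_t=s_0\mu^t,$$ where $\Psi_t=\sum_{k=1}^t\mu^k$, and $\alpha_0>0$, $\gamma_0\in(0,1/(4G_2^2)]$, $s_0>0$ and $\mu\in(0,1)$ are constants. Then, for any $T\in\mathbb{N}_+$, $$\mathbf{E}_{\mathcal{C}}[\mathrm{Net\text{-}Reg}(T)]=\mathcal{O}(\sqrt T),\qquad \mathbf{E}_{\mathcal{C}}[\mathrm{Net\text{-}CCV}(T)]=\mathcal{O}(T^{3/4}).$$ Moreover, if in addition Slater's condition holds, i.e., there exist a point $x_s\in\mathbb{X}$ and a constant $\varsigma_s>0$ such that $g_t(x_s)\le-\varsigma_s\mathbf{1}_m$ for all $t\in\mathbb{N}_+$, then $$\mathbf{E}_{\mathcal{C}}[\mathrm{Net\text{-}CCV}(T)]=\mathcal{O}(\sqrt T).$$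
   Context: Notation. $[n]=\{1,\dots,n\}$. Vector inequalities are componentwise. $\|\cdot\|$ is the Euclidean norm (induced operator norm for matrices), $\|\cdot\|_d$ is the $\ell_d$ norm. $\mathbf{1}_m,\mathbf{0}_m$ are the all-ones and all-zeros vectors in $\mathbb{R}^m$. $\mathcal{P}_{\mathbb{X}}$ is Euclidean projection onto $\mathbb{X}$, and $[x]_+$ is the projection onto the nonnegative orthant (componentwise positive part). $\nabla f(x)$ denotes the subgradient of $f$ at $x$; for the convex vector-valued $g_{i,t}$, $\nabla g_{i,t}(x)\in\mathbb{R}^{m_i\times p}$ is a matrix whose rows are subgradients of the components, so $g_{i,t}(y)\ge g_{i,t}(x)+\nabla g_{i,t}(x)(y-x)$ for $x,y\in\mathbb{X}$. $\mathcal{O}(\cdot)$ is with respect to $T$, with constants independent of $T$. Network. At iteration $t\in\mathbb{N}_+$, $n$ agents communicate over a directed graph $\mathcal{G}_t=(\mathcal{V},\mathcal{E}_t)$, $\mathcal{V}=[n]$, $\mathcal{E}_t\subseteq\mathcal{V}\times\mathcal{V}$; $(j,i)\in\mathcal{E}_t$ means agent $i$ can receive information from agent $j$. $W_t\in\mathbb{R}^{n\times n}$ is the mixing matrix associated with $\mathcal{G}_t$. Problem. $f_{i,t}:\mathbb{X}\to\mathbb{R}$ are (possibly nonconvex) local loss functions and $g_{i,t}:\mathbb{X}\to\mathbb{R}^{m_i}$ are convex (componentwise) local constraint functions. $f_t(x)=\frac1n\sum_{j=1}^nf_{j,t}(x)$ (with $\nabla f_t=\frac1n\sum_j\nabla f_{j,t}$),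 $g_t(x)=\mathrm{col}(g_{1,t}(x),\dots,g_{n,t}(x))\in\mathbb{R}^m$ (concatenation), $m=\sum_im_i$. The feasible set $\mathcal{X}_T=\{x\in\mathbb{X}:g_t(x)\le\mathbf{0}_m,\ \forall t\in[T]\}$ is assumed nonempty for all $T\in\mathbb{N}_+$. Performance metrics. $$\mathrm{Net\text{-}Reg}(T)=\frac1n\sum_{i=1}^n\Big(\sum_{t=1}^T\langle\nabla f_t(x_{i,t}),x_{i,t}\rangle-\inf_{x\in\mathcal{X}_T}\Big\langle\sum_{t=1}^T\nabla f_t(x_{i,t}),x\Big\rangle\Big),$$ $$\mathrm{Net\text{-}CCV}(T)=\frac1n\sum_{i=1}^n\sum_{t=1}^T\|[g_t(x_{i,t})]_+\|.$$ Algorithm (distributed online primal–dual algorithm with compressed communication). Inputs: positive sequences $\{\alpha_t\}$ (stepsize, non-increasing), $\{s_t\}$ (scaling, non-increasing), $\{\gamma_t\}$ (regularization, non-decreasing). Initialize $\hat z_{j,0}=\mathbf{0}_p$ and $z_{i,1}\in\mathbb{X}$ for all $i,j\in[n]$. For $t=1,2,\dots$ and every $i,j\in[n]$: $$\hat z_{j,t}=\mathcal{P}_{\mathbb{X}}\big(\hat z_{j,t-1}+s_t\,\mathcal{C}((z_{j,t}-\hat z_{j,t-1})/s_t)\big),\qquad x_{i,t}=\sum_{j=1}^n[W_t]_{ij}\hat z_{j,t},$$ $$v_{i,t+1}=\gamma_t[g_{i,t}(x_{i,t})]_+,\qquad \omega_{i,t+1}=\nabla f_{i,t}(x_{i,t})+(\nabla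 g_{i,t}(x_{i,t}))^Tv_{i,t+1},\qquad z_{i,t+1}=\mathcal{P}_{\mathbb{X}}(x_{i,t}-\alpha_t\omega_{i,t+1}).$$ For each $j$ and $t$ the compressed vector is one realization broadcast by agent $j$, so $\hat z_{j,t}$ is common to all agents. $\mathbf{E}_{\mathcal{C}}$ is expectation over the internal randomness of the compressor; each call of the compressor uses fresh randomness independent of the past. *)

theory Defs
  imports "HOL-Probability.Probability"
begin

(* Conventions: the agents are the elements of a finite type 'n, so n = CARD('n); the decision
   space is real^'p; time is a nat, with iterations t >= 1.  The dimension m i of the constraint
   of agent i depends on the agent, so a vector of R^(m i) is a function on nat read on the
   indices k < m i, and an (m i) x p matrix is the function giving its rows k < m i.  Loss and
   constraint functions are total functions of which only the values on X matter. *)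

definition lp_norm :: "ereal \<Rightarrow> real^'p \<Rightarrow> real" where
  "lp_norm d x = (if d = \<infinity> then infnorm x
     else (\<Sum>i\<in>UNIV. \<bar>x $ i\<bar> powr real_of_ereal d) powr (1 / real_of_ereal d))"

(* Same formula as the library's onorm, for the matrix with rows A 0, ..., A (k - 1). *)
definition op_norm :: "nat \<Rightarrow> (nat \<Rightarrow> real^'p) \<Rightarrow> real" where
  "op_norm k A = (SUP h. L2_set (\<lambda>l. A l \<bullet> h) {..<k} / norm h)"

(* Frechet (regular) subgradient of a possibly nonconvex function on X: the gradient if f is
   differentiable, the usual subgradient if f is convex. *)
definition subgradient_on :: "(real^'p) set \<Rightarrow> (real^'p \<Rightarrow> real) \<Rightarrow> real^'p \<Rightarrow> real^'p \<Rightarrow> bool" where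
  "subgradient_on X f x v \<longleftrightarrow>
     (\<forall>\<epsilon>>0. \<forall>\<^sub>F y in at x within X. f y \<ge> f x + v \<bullet> (y - x) - \<epsilon> * norm (y - x))"

definition doubly_stochastic :: "real^'n^'n \<Rightarrow> bool" where
  "doubly_stochastic A \<longleftrightarrow> (\<forall>i j. A $ i $ j \<ge> 0) \<and>
     (\<forall>i. (\<Sum>j\<in>UNIV. A $ i $ j) = 1) \<and> (\<forall>j. (\<Sum>i\<in>UNIV. A $ i $ j) = 1)"

definition strongly_connected :: "('n \<times> 'n) set \<Rightarrow> bool" where
  "strongly_connected E \<longleftrightarrow> (\<forall>i j. (i, j) \<in> E\<^sup>*)"

(* \<xi> j t is the internal randomness (with law K) of the call of the compressor made by agent j
   at time t.  It is independent of all calls made at earlier times; nothing is required about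
   the joint law of the calls made by different agents at the same time. *)
definition fresh_randomness ::
  "'w measure \<Rightarrow> 'r measure \<Rightarrow> ('n \<Rightarrow> nat \<Rightarrow> 'w \<Rightarrow> 'r) \<Rightarrow> bool" where
  "fresh_randomness M K \<xi> \<longleftrightarrow>
     (\<forall>j. \<forall>t\<ge>1. \<xi> j t \<in> measurable M K \<and> distr M K (\<xi> j t) = K \<and>
        prob_space.indep_set M
          {\<xi> j t -` A \<inter> space M | A. A \<in> sets K}
          (sigma_sets (space M)
             {\<xi> k s -` A \<inter> space M | k s A. 1 \<le> s \<and> s < t \<and> A \<in> sets K}))"

(* One trajectory of the algorithm.  cmp u r is the output of the compressor on input u with
   internal randomness r, and \<xi> j t is the realization used by agent j at time t.  The gradient
   oracles are df i t and dg i t (rows of the Jacobian); z1 gives the initial points. *)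
definition algorithm_run ::
  "(real^'p) set \<Rightarrow> (nat \<Rightarrow> real^'n^'n) \<Rightarrow> ('n \<Rightarrow> nat)
   \<Rightarrow> ('n \<Rightarrow> nat \<Rightarrow> real^'p \<Rightarrow> real^'p)
   \<Rightarrow> ('n \<Rightarrow> nat \<Rightarrow> real^'p \<Rightarrow> nat \<Rightarrow> real) \<Rightarrow> ('n \<Rightarrow> nat \<Rightarrow> real^'p \<Rightarrow> nat \<Rightarrow> real^'p)
   \<Rightarrow> (real^'p \<Rightarrow> 'r \<Rightarrow> real^'p) \<Rightarrow> (nat \<Rightarrow> real) \<Rightarrow> (nat \<Rightarrow> real) \<Rightarrow> (nat \<Rightarrow> real)
   \<Rightarrow> ('n \<Rightarrow> real^'p) \<Rightarrow> ('n \<Rightarrow> nat \<Rightarrow> 'r)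
   \<Rightarrow> ('n \<Rightarrow> nat \<Rightarrow> real^'p) \<Rightarrow> ('n \<Rightarrow> nat \<Rightarrow> real^'p) \<Rightarrow> ('n \<Rightarrow> nat \<Rightarrow> real^'p)
   \<Rightarrow> ('n \<Rightarrow> nat \<Rightarrow> nat \<Rightarrow> real) \<Rightarrow> ('n \<Rightarrow> nat \<Rightarrow> real^'p) \<Rightarrow> bool" where
  "algorithm_run X W m df g dg cmp \<alpha> \<gamma> s z1 \<xi> z zhat x v \<omega> \<longleftrightarrow>
     (\<forall>j. zhat j 0 = 0) \<and>
     (\<forall>i. z i 1 = z1 i) \<and>
     (\<forall>t\<ge>1. \<forall>i.
        zhat i t = closest_point X
          (zhat i (t - 1) + s t *\<^sub>R cmp ((1 / s t) *\<^sub>R (z i t - zhat i (t - 1))) (\<xi> i t)) \<and>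
        x i t = (\<Sum>j\<in>UNIV. (W t $ i $ j) *\<^sub>R zhat j t) \<and>
        (\<forall>k<m i. v i (t + 1) k = \<gamma> t * max 0 (g i t (x i t) k)) \<and>
        \<omega> i (t + 1) = df i t (x i t) + (\<Sum>k<m i. v i (t + 1) k *\<^sub>R dg i t (x i t) k) \<and>
        z i (t + 1) = closest_point X (x i t - \<alpha> t *\<^sub>R \<omega> i (t + 1)))"

definition feasible ::
  "(real^'p) set \<Rightarrow> ('n \<Rightarrow> nat) \<Rightarrow> ('n \<Rightarrow> nat \<Rightarrow> real^'p \<Rightarrow> nat \<Rightarrow> real) \<Rightarrow> nat \<Rightarrow> (real^'p) set" where
  "feasible X m g T = {x \<in> X. \<forall>t\<in>{1..T}. \<forall>i. \<forall>k<m i. g i t x k \<le> 0}"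

definition avg_grad ::
  "('n::finite \<Rightarrow> nat \<Rightarrow> real^'p \<Rightarrow> real^'p) \<Rightarrow> nat \<Rightarrow> real^'p \<Rightarrow> real^'p" where
  "avg_grad df t x = (1 / real CARD('n)) *\<^sub>R (\<Sum>j\<in>UNIV. df j t x)"

definition net_reg ::
  "(real^'p) set \<Rightarrow> ('n::finite \<Rightarrow> nat) \<Rightarrow> ('n \<Rightarrow> nat \<Rightarrow> real^'p \<Rightarrow> real^'p)
   \<Rightarrow> ('n \<Rightarrow> nat \<Rightarrow> real^'p \<Rightarrow> nat \<Rightarrow> real) \<Rightarrow> ('n \<Rightarrow> nat \<Rightarrow> real^'p) \<Rightarrow> nat \<Rightarrow> real" where
  "net_reg X m df g x T = (1 / real CARD('n)) *
     (\<Sum>i\<in>UNIV. (\<Sum>t=1..T. avg_grad df t (x i t) \<bullet> x i t)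
        - (INF y\<in>feasible X m g T. (\<Sum>t=1..T. avg_grad df t (x i t)) \<bullet> y))"

(* The components of the concatenation g_t are indexed by the pairs (j, k) with k < m j. *)
definition net_ccv ::
  "('n::finite \<Rightarrow> nat) \<Rightarrow> ('n \<Rightarrow> nat \<Rightarrow> real^'p \<Rightarrow> nat \<Rightarrow> real)
   \<Rightarrow> ('n \<Rightarrow> nat \<Rightarrow> real^'p) \<Rightarrow> nat \<Rightarrow> real" where
  "net_ccv m g x T = (1 / real CARD('n)) *
     (\<Sum>i\<in>UNIV. \<Sum>t=1..T.
        L2_set (\<lambda>(j, k). max 0 (g j t (x i t) k)) (SIGMA j:UNIV. {..<m j}))"

end

theory Submission
  imports Defs
begin

text \<open>Testing the projection step against a feasible point \<open>y\<close> gives a descent inequality for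
  \<open>V t = (\<Sum>j. norm (z j t - y) ^ 2)\<close>. Since \<open>\<alpha> t * \<gamma> t = \<gamma>0\<close> is constant and \<open>\<gamma>0 * G2^2 \<le> 1/4\<close>, the
  dual term leaves a negative multiple of the squared violations, so these sum up to
  \<open>O(sqrt T)\<close>; at a Slater point it also leaves a multiple of the violations themselves. The mixing
  matrices contract the diameter of the iterates by a fixed factor over a fixed window; summing
  this recursion bounds the total disagreement of the agents by the total of the steps,
  violations and compression errors. In the regret the violations reappear linearly; they are absorbed by the
  squared violations over \<open>\<alpha> t\<close> in the descent inequality. Finally the compression error
  at time \<open>t\<close> has expectation at most a constant times \<open>s t\<close>, because each call is independent of the past.\<close>

section \<open>Consensus under perturbed mixing\<close>

text \<open>The dual variable is recomputed from the current violation, so the move from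
  \<open>x i t\<close> to \<open>z i (t + 1)\<close> has a part proportional to the violation that
  does not shrink with \<open>\<alpha> t\<close>. Disagreement can therefore be bounded only through
  violations, while both performance metrics test the point of one agent against the data of all
  agents and so require the disagreement. This circle is the reason for retaining squared violations
  in the descent inequality. The compression errors enter the pathwise bounds linearly with
  nonnegative coefficients. Hence only their means matter, and the joint law of simultaneous calls
  never enters. The quantity \<Psi> stays between \<mu> and \<open>1 / (1 - \<mu>)\<close>, so
  \<open>\<alpha> t\<close> has the order of \<open>1 / sqrt t\<close>. The geometric decay of
  \<open>s t\<close> keeps the sum of \<open>s t / \<alpha> t\<close> at order
  \<open>sqrt T\<close>. The comparison point may change with \<open>T\<close>, so no constant may
  depend on it.\<close>

definition mix :: "real^'n^'n \<Rightarrow> ('n::finite \<Rightarrow> 'a::real_normed_vector) \<Rightarrow> 'n \<Rightarrow> 'a" where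
  "mix A x i = (\<Sum>j\<in>UNIV. (A $ i $ j) *\<^sub>R x j)"

definition row_stochastic :: "real^'n^'n \<Rightarrow> bool" where
  "row_stochastic A \<longleftrightarrow> (\<forall>i j. A $ i $ j \<ge> 0) \<and> (\<forall>i. (\<Sum>j\<in>UNIV. A $ i $ j) = 1)"

definition spread :: "('n::finite \<Rightarrow> 'a::real_normed_vector) \<Rightarrow> real" where
  "spread x = Max (range (\<lambda>(i, j). norm (x i - x j)))"

lemma norm_diff_le_spread: "norm (x i - x j) \<le> spread x"
proof -
  have "norm (x i - x j) \<in> range (\<lambda>(i, j). norm (x i - x j))" by (metis (mono_tags) case_prod_conv rangeI)
  then show ?thesis unfolding spread_def by (intro Max_ge) auto
qed

lemma spread_le: "(\<And>i j. norm (x i - x j) \<le> c) \<Longrightarrow> spread x \<le> c"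
  unfolding spread_def by (subst Max_le_iff) auto

lemma spread_nonneg: "0 \<le> spread x"
  using norm_diff_le_spread[of x undefined undefined] by simp

lemma row_stochastic_mult:
  assumes "row_stochastic A" "row_stochastic (B :: real^'n::finite^'n)"
  shows "row_stochastic (A ** B)"
proof -
  have "(\<Sum>j\<in>UNIV. (A ** B) $ i $ j) = 1" for i
  proof -
    have "(\<Sum>j\<in>UNIV. (A ** B) $ i $ j) = (\<Sum>k\<in>UNIV. A $ i $ k * (\<Sum>j\<in>UNIV. B $ k $ j))"
      unfolding matrix_matrix_mult_def sum_distrib_left by (simp, subst sum.swap, simp)
    with assms show ?thesis by (simp add: row_stochastic_def)
  qed
  with assms show ?thesis
    by (auto simp: row_stochastic_def matrix_matrix_mult_def intro!: sum_nonneg)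
qed

lemma mix_mult: "mix (A ** B) x = mix A (mix B (x :: 'n::finite \<Rightarrow> 'a::real_normed_vector))"
proof
  fix i
  have "mix (A ** B) x i = (\<Sum>j\<in>UNIV. \<Sum>k\<in>UNIV. (A $ i $ k * B $ k $ j) *\<^sub>R x j)"
    by (simp add: mix_def matrix_matrix_mult_def scaleR_sum_left)
  also have "\<dots> = mix A (mix B x) i"
    unfolding mix_def scaleR_sum_right by (subst sum.swap) simp
  finally show "mix (A ** B) x i = mix A (mix B x) i" .
qed

lemma mix_diff: "mix A x i - mix A y i = mix A (\<lambda>j. x j - y j) i"
  by (simp add: mix_def sum_subtractf scaleR_diff_right)

lemma norm_mix_le:
  assumes "row_stochastic A" "\<And>j. norm (x j) \<le> c"
  shows "norm (mix A x i) \<le> c"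
proof -
  have "norm (mix A x i) \<le> (\<Sum>j\<in>UNIV. norm ((A $ i $ j) *\<^sub>R x j))"
    unfolding mix_def by (rule norm_sum)
  also have "\<dots> \<le> (\<Sum>j\<in>UNIV. A $ i $ j * c)"
    using assms by (intro sum_mono) (auto simp: row_stochastic_def intro!: mult_left_mono)
  also have "\<dots> = c" using assms by (simp add: row_stochastic_def flip: sum_distrib_right)
  finally show ?thesis .
qed

text \<open>The difference of two rows of \<open>A x\<close> is the average of \<open>x k - x l\<close> with weights
  \<open>A i k * A j l\<close>; the terms with \<open>k = l\<close> vanish, and their total weight is at least \<open>\<eta>\<close>.\<close>

lemma spread_mix_le:
  fixes x :: "'n::finite \<Rightarrow> 'a::real_normed_vector"
  assumes A: "row_stochastic A" and \<eta>: "\<And>i j. \<eta> \<le> A $ i $ j"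
  shows "spread (mix A x) \<le> (1 - \<eta>) * spread x"
proof (rule spread_le)
  fix i j
  have pos: "0 \<le> A $ i $ k" for i k using A by (simp add: row_stochastic_def)
  have one: "(\<Sum>k\<in>UNIV. A $ i $ k) = 1" for i using A by (simp add: row_stochastic_def)
  have 1: "mix A x i = (\<Sum>k\<in>UNIV. \<Sum>l\<in>UNIV. (A $ i $ k * A $ j $ l) *\<^sub>R x k)"
    by (simp add: mix_def one flip: scaleR_sum_left sum_distrib_left)
  have 2: "mix A x j = (\<Sum>k\<in>UNIV. \<Sum>l\<in>UNIV. (A $ i $ k * A $ j $ l) *\<^sub>R x l)"
    by (subst sum.swap) (simp add: mix_def one flip: scaleR_sum_left sum_distrib_right)
  have "norm (mix A x i - mix A x j)
      = norm (\<Sum>k\<in>UNIV. \<Sum>l\<in>UNIV. (A $ i $ k * A $ j $ l) *\<^sub>R (x k - x l))"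
    unfolding 1 2 by (simp add: sum_subtractf scaleR_diff_right)
  also have "\<dots> \<le> (\<Sum>k\<in>UNIV. \<Sum>l\<in>UNIV. A $ i $ k * A $ j $ l * norm (x k - x l))"
    by (intro order_trans[OF norm_sum] sum_mono) (simp add: pos abs_mult)
  also have "\<dots> \<le> (\<Sum>k\<in>UNIV. \<Sum>l\<in>UNIV. A $ i $ k * A $ j $ l * (spread x - (if k = l then spread x else 0)))"
    by (intro sum_mono mult_left_mono) (auto simp: pos norm_diff_le_spread)
  also have "\<dots> = (\<Sum>k\<in>UNIV. \<Sum>l\<in>UNIV. A $ i $ k * A $ j $ l * spread x)
      - (\<Sum>k\<in>UNIV. A $ i $ k * A $ j $ k * spread x)"
    by (simp add: right_diff_distrib sum_subtractf if_distrib[where f="\<lambda>u. _ * u"] sum.delta cong: if_cong)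
  also have "\<dots> = (1 - (\<Sum>k\<in>UNIV. A $ i $ k * A $ j $ k)) * spread x"
    by (simp add: one algebra_simps flip: sum_distrib_left sum_distrib_right)
  also have "\<dots> \<le> (1 - \<eta>) * spread x"
  proof -
    have "\<eta> = (\<Sum>k\<in>UNIV. \<eta> * A $ j $ k)" by (simp add: one flip: sum_distrib_left)
    also have "\<dots> \<le> (\<Sum>k\<in>UNIV. A $ i $ k * A $ j $ k)"
      by (intro sum_mono mult_right_mono) (auto simp: pos \<eta>)
    finally show ?thesis by (intro mult_right_mono) (auto simp: spread_nonneg)
  qed
  finally show "norm (mix A x i - mix A x j) \<le> (1 - \<eta>) * spread x" .
qed

section \<open>Products of mixing matrices over a window of time\<close>

text \<open>The newest matrix multiplies on the left and the first factor is
  \<open>W (t + 1)\<close>. This is the evolution from time \<open>t\<close> to time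
  \<open>t + k\<close>, and \<open>W 0\<close>, which is unconstrained, never occurs.\<close>

primrec transition :: "(nat \<Rightarrow> real^'n^'n) \<Rightarrow> nat \<Rightarrow> nat \<Rightarrow> real^'n^'n" where
  "transition W t 0 = mat 1"
| "transition W t (Suc k) = W (t + Suc k) ** transition W t k"

lemma row_stochastic_transition:
  assumes "\<And>t. t \<ge> 1 \<Longrightarrow> row_stochastic (W t :: real^'n::finite^'n)"
  shows "row_stochastic (transition W t k)"
proof (induction k)
  case 0 show ?case by (simp add: row_stochastic_def mat_def)
next
  case (Suc k) then show ?case by (simp add: row_stochastic_mult assms)
qed

text \<open>A path from inside \<open>S\<close> to outside must cross the boundary of
  \<open>S\<close>. Strong connectivity is used only in this form.\<close>

lemma edge_leaving:
  assumes "strongly_connected F" "S \<noteq> {}" "S \<noteq> UNIV"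
  obtains a b where "(a, b) \<in> F" "a \<in> S" "b \<notin> S"
proof -
  obtain i j where ij: "i \<in> S" "j \<notin> S" using assms by auto
  have "(i, j) \<in> F\<^sup>*" using assms by (simp add: strongly_connected_def)
  then have "j \<notin> S \<Longrightarrow> \<exists>a b. (a, b) \<in> F \<and> a \<in> S \<and> b \<notin> S"
    using ij(1) by (induction rule: rtrancl_induct) auto
  with ij that show ?thesis by blast
qed

text \<open>The agents reached from \<open>j\<close> with weight at least \<open>w ^ k\<close> form a set that never shrinks, since
  the diagonal weights are at least \<open>w\<close>, and that grows over every window of length \<open>B\<close>.\<close>

lemma transition_lower_bound:
  fixes W :: "nat \<Rightarrow> real^'n::finite^'n" and E :: "nat \<Rightarrow> ('n \<times> 'n) set"
  assumes w: "0 < w"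
    and W_weights: "\<And>t i j. t \<ge> 1 \<Longrightarrow> (j, i) \<in> E t \<or> i = j \<Longrightarrow> w \<le> W t $ i $ j"
    and rs: "\<And>t. t \<ge> 1 \<Longrightarrow> row_stochastic (W t)"
    and B: "B > 0" "\<And>t. t \<ge> 1 \<Longrightarrow> strongly_connected (\<Union>l\<in>{0..B - 1}. E (t + l))"
  shows "w ^ (CARD('n) * B) \<le> transition W t (CARD('n) * B) $ i $ j"
proof -
  define S where "S k = {i. w ^ k \<le> transition W t k $ i $ j}" for k
  have step: "b \<in> S (Suc k)" if "a \<in> S k" "(a, b) \<in> E (t + Suc k) \<or> a = b" for a b k
  proof -
    have pos: "0 \<le> W (t + Suc k) $ b $ l" "0 \<le> transition W t k $ l $ j" for l
      using rs[of "t + Suc k"] row_stochastic_transition[of W t k, OF rs] by (auto simp: row_stochastic_def)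
    have "w ^ Suc k \<le> W (t + Suc k) $ b $ a * transition W t k $ a $ j"
      using that w pos W_weights[of "t + Suc k" a b] unfolding S_def power_Suc by (intro mult_mono) auto
    also have "\<dots> \<le> (\<Sum>l\<in>UNIV. W (t + Suc k) $ b $ l * transition W t k $ l $ j)"
      using pos by (intro member_le_sum) auto
    finally show ?thesis by (simp add: S_def matrix_matrix_mult_def)
  qed
  have mono: "S k \<subseteq> S (k + l)" for k l
    by (induction l) (use step in auto)
  have nonempty: "j \<in> S 0" by (simp add: S_def mat_def)
  have grow: "\<exists>b. b \<in> S (k + B) \<and> b \<notin> S k" if "S k \<noteq> UNIV" for k
  proof -
    have "S k \<noteq> {}" using mono[of 0 k] nonempty by auto
    \<comment> \<open>The first \<open>k\<close> factors use the matrices up to time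
      \<open>t + k\<close>, so the next window opens at \<open>t + Suc k\<close>.\<close>
    have "strongly_connected (\<Union>l\<in>{0..B - 1}. E (t + Suc k + l))" by (rule B(2)) simp
    from edge_leaving[OF this \<open>S k \<noteq> {}\<close> that]
    obtain a b where ab: "(a, b) \<in> (\<Union>l\<in>{0..B - 1}. E (t + Suc k + l))" "a \<in> S k" "b \<notin> S k" .
    then obtain l where l: "l \<le> B - 1" "(a, b) \<in> E (t + Suc (k + l))" by (auto simp: add.assoc)
    have "b \<in> S (Suc (k + l))" using step[of a "k + l" b] ab l mono[of k l] by auto
    \<comment> \<open>The crossing edge may occur anywhere in the window; self-loops carry the new
      agent to its end.\<close>
    moreover have "k + B = Suc (k + l) + (B - Suc l)" using l B by simp
    ultimately show ?thesis using mono[of "Suc (k + l)" "B - Suc l"] ab by auto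
  qed
  have "S (c * B) = UNIV \<or> Suc c \<le> card (S (c * B))" for c
  proof (induction c)
    case 0 show ?case using nonempty by (auto simp: Suc_le_eq card_gt_0_iff)
  next
    case (Suc c)
    show ?case
    proof (cases "S (c * B) = UNIV")
      case True then show ?thesis using mono[of "c * B" B] by (auto simp: add.commute)
    next
      case False
      from grow[OF this] mono[of "c * B" B] have "S (c * B) \<subset> S (Suc c * B)"
        by (auto simp: add.commute)
      then have "card (S (c * B)) < card (S (Suc c * B))" by (intro psubset_card_mono) auto
      with Suc False show ?thesis by auto
    qed
  qed
  \<comment> \<open>A set of \<open>Suc (CARD('n))\<close> agents is impossible, so only the first
    alternative survives after \<open>CARD('n)\<close> windows.\<close>
  from this[of "CARD('n)"] have "S (CARD('n) * B) = UNIV"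
    using card_mono[of UNIV "S (CARD('n) * B)"] by auto
  then show ?thesis by (auto simp: S_def)
qed

text \<open>Compare with the unperturbed evolution started at \<open>x t\<close>, which contracts.
  Averaging never enlarges an error, so the deviation after \<open>k\<close> steps is at most the
  sum of the perturbations; the factor 2 appears because both agents of a pair deviate.\<close>

lemma spread_perturbed:
  fixes W :: "nat \<Rightarrow> real^'n::finite^'n" and x :: "nat \<Rightarrow> 'n \<Rightarrow> 'a::real_normed_vector"
  assumes rs: "\<And>t. t \<ge> 1 \<Longrightarrow> row_stochastic (W t)"
    and x: "\<And>k. k \<ge> t \<Longrightarrow> x (Suc k) = mix (W (Suc k)) (\<lambda>j. x k j + p (Suc k) j)"
    and p: "\<And>k j. k > t \<Longrightarrow> norm (p k j) \<le> \<pi> k"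
    and \<eta>: "\<And>i j. \<eta> \<le> transition W t N $ i $ j"
  shows "spread (x (t + N)) \<le> (1 - \<eta>) * spread (x t) + 2 * (\<Sum>k\<in>{1..N}. \<pi> (t + k))"
proof -
  define y where "y k = mix (transition W t k) (x t)" for k
  have y_Suc: "y (Suc k) = mix (W (t + Suc k)) (y k)" for k by (simp add: y_def mix_mult)
  have d: "norm (x (t + k) i - y k i) \<le> (\<Sum>l\<in>{1..k}. \<pi> (t + l))" for k i
  proof (induction k arbitrary: i)
    case 0
    have "y 0 i = x t i"
      by (simp add: y_def mix_def mat_def if_distrib[where f="\<lambda>u. u *\<^sub>R _"] sum.delta cong: if_cong)
    then show ?case by simp
  next
    case (Suc k)
    have "norm (x (t + k) j + p (Suc (t + k)) j - y k j) \<le> (\<Sum>l\<in>{1..Suc k}. \<pi> (t + l))" for j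
      using Suc[of j] p[of "Suc (t + k)" j] norm_triangle_ineq[of "x (t + k) j - y k j" "p (Suc (t + k)) j"]
      by (simp add: algebra_simps)
    then show ?case
      using x[of "t + k"] rs[of "Suc (t + k)"] by (simp add: y_Suc mix_diff norm_mix_le)
  qed
  show ?thesis
  proof (rule spread_le)
    fix i j
    have "norm (y N i - y N j) \<le> (1 - \<eta>) * spread (x t)"
      unfolding y_def using spread_mix_le[of "transition W t N" \<eta> "x t"] \<eta> row_stochastic_transition[of W t N, OF rs]
      by (auto intro: order_trans[OF norm_diff_le_spread])
    moreover have "norm (x (t + N) i - x (t + N) j)
        \<le> norm (x (t + N) i - y N i) + norm (x (t + N) j - y N j) + norm (y N i - y N j)"
      using norm_triangle_ineq[of "x (t + N) i - y N i" "y N i - y N j"]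
        norm_triangle_ineq4[of "x (t + N) i - y N j" "x (t + N) j - y N j"] by simp
    ultimately show "norm (x (t + N) i - x (t + N) j)
        \<le> (1 - \<eta>) * spread (x t) + 2 * (\<Sum>k\<in>{1..N}. \<pi> (t + k))"
      using d[of N i] d[of N j] by linarith
  qed
qed

section \<open>Scalar summation inequalities\<close>

text \<open>Summing the recursion over \<open>t\<close> and moving \<open>(1 - \<eta>)\<close> times
  the sum to the left leaves \<open>\<eta>\<close> times the sum, so no geometric series has to be
  unrolled. The first \<open>N\<close> terms, which the recursion does not reach, cost
  \<open>N * D\<close>; every perturbation is counted at most once for each of the \<open>N\<close>
  offsets.\<close>

lemma sum_contraction:
  fixes d \<pi> :: "nat \<Rightarrow> real"
  assumes d: "\<And>t. t \<ge> 1 \<Longrightarrow> 0 \<le> d t" "\<And>t. t \<ge> 1 \<Longrightarrow> d t \<le> D"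
    and \<eta>: "0 \<le> \<eta>" "\<eta> \<le> 1" and \<pi>: "\<And>t. 0 \<le> \<pi> t"
    and step: "\<And>t. t \<ge> 1 \<Longrightarrow> d (t + N) \<le> (1 - \<eta>) * d t + 2 * (\<Sum>k\<in>{1..N}. \<pi> (t + k))"
  shows "\<eta> * (\<Sum>t=1..T. d t) \<le> real N * D + 2 * real N * (\<Sum>t=1..T. \<pi> t)"
proof (cases "T \<le> N")
  case True
  have "0 \<le> D" using d[of 1] by linarith
  have "(\<Sum>t=1..T. d t) \<le> (\<Sum>t=1..T. D)" by (intro sum_mono d) auto
  also have "\<dots> \<le> real N * D" using True \<open>0 \<le> D\<close> by (auto intro: mult_right_mono)
  finally have "(\<Sum>t=1..T. d t) \<le> real N * D" .
  moreover have "\<eta> * (\<Sum>t=1..T. d t) \<le> 1 * (\<Sum>t=1..T. d t)"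
    using \<eta> d by (intro mult_right_mono sum_nonneg) auto
  moreover have "0 \<le> 2 * real N * (\<Sum>t=1..T. \<pi> t)" by (simp add: sum_nonneg \<pi>)
  ultimately show ?thesis by linarith
next
  case False
  define U where "U = T - N"
  have T: "T = U + N" using False by (simp add: U_def)
  have "(\<Sum>t=1..T. d t) = (\<Sum>t=1..N. d t) + (\<Sum>t=1..U. d (t + N))"
    unfolding T add.commute[of U]
    using sum.ub_add_nat[of 1 N d U] sum.shift_bounds_cl_nat_ivl[of d 1 N U] by (simp add: add.commute)
  also have "(\<Sum>t=1..N. d t) \<le> (\<Sum>t=1..N. D)" by (intro sum_mono d) auto
  also have "(\<Sum>t=1..U. d (t + N)) \<le> (\<Sum>t=1..U. (1 - \<eta>) * d t + 2 * (\<Sum>k\<in>{1..N}. \<pi> (t + k)))"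
    by (intro sum_mono step) auto
  also have "\<dots> = (1 - \<eta>) * (\<Sum>t=1..U. d t) + 2 * (\<Sum>k\<in>{1..N}. \<Sum>t=1..U. \<pi> (t + k))"
    using sum.swap[of "\<lambda>t k. \<pi> (t + k)" "{1..N}" "{1..U}"]
    by (simp add: sum.distrib flip: sum_distrib_left)
  also have "(1 - \<eta>) * (\<Sum>t=1..U. d t) \<le> (1 - \<eta>) * (\<Sum>t=1..T. d t)"
    using d \<eta> by (intro mult_left_mono sum_mono2) (auto simp: T)
  also have "(\<Sum>k\<in>{1..N}. \<Sum>t=1..U. \<pi> (t + k)) \<le> (\<Sum>k\<in>{1..N}. \<Sum>t=1..T. \<pi> t)"
  proof (intro sum_mono)
    fix k assume k: "k \<in> {1..N}"
    have "(\<Sum>t=1..U. \<pi> (t + k)) = (\<Sum>t\<in>(\<lambda>t. t + k) ` {1..U}. \<pi> t)"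
      by (subst sum.reindex) (auto simp: inj_on_def)
    also have "\<dots> \<le> (\<Sum>t=1..T. \<pi> t)"
      using k by (intro sum_mono2) (auto simp: T \<pi>)
    finally show "(\<Sum>t=1..U. \<pi> (t + k)) \<le> (\<Sum>t=1..T. \<pi> t)" .
  qed
  finally show ?thesis using \<eta> by (simp add: algebra_simps)
qed

text \<open>Summation by parts with nondecreasing weights. It serves with constant weight for the
  violations and with a weight proportional to \<open>1 / \<alpha> t\<close> for the regret.\<close>

lemma abel_bound:
  fixes b V :: "nat \<Rightarrow> real"
  assumes b: "\<And>t. t \<ge> 1 \<Longrightarrow> 0 \<le> b t" "\<And>t. t \<ge> 1 \<Longrightarrow> b t \<le> b (Suc t)"
    and V: "\<And>t. t \<ge> 1 \<Longrightarrow> 0 \<le> V t" "\<And>t. t \<ge> 1 \<Longrightarrow> V t \<le> c" and T: "T \<ge> 1"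
  shows "(\<Sum>t=1..T. b t * (V t - V (Suc t))) \<le> b T * c"
proof -
  \<comment> \<open>The term \<open>V (Suc T)\<close> has to be kept for the induction: as
    \<open>c - V (Suc T)\<close> is nonnegative, \<open>b T\<close> may be raised to
    \<open>b (Suc T)\<close>, after which the next summand telescopes.\<close>
  have "(\<Sum>t=1..T. b t * (V t - V (Suc t))) \<le> b T * (c - V (Suc T))"
    using T
  proof (induction T rule: dec_induct)
    case base
    then show ?case using b(1)[of 1] V(2)[of 1] by (auto intro!: mult_left_mono)
  next
    case (step T)
    have "b T * (c - V (Suc T)) \<le> b (Suc T) * (c - V (Suc T))"
      using step b(2)[of T] V(2)[of "Suc T"] by (intro mult_right_mono) auto
    with step show ?case by (simp add: algebra_simps)
  qed
  also have "\<dots> \<le> b T * c" using b(1)[OF T] V(1)[of "Suc T"] by (intro mult_left_mono) auto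
  finally show ?thesis .
qed

text \<open>Each summand is at most twice an increment of the square root. With
  \<open>b * b = a * a + 1\<close> this is \<open>2 * a * b \<le> a * a + b * b\<close> divided by
  \<open>b\<close>.\<close>

lemma sum_inverse_sqrt_le: "(\<Sum>t=1..T. 1 / sqrt (real t)) \<le> 2 * sqrt (real T)"
proof (induction T)
  case (Suc T)
  define a b where "a = sqrt (real T)" and "b = sqrt (real (Suc T))"
  have ab: "b * b = a * a + 1" "b > 0" "a \<ge> 0" by (auto simp: a_def b_def)
  have "2 * a * b \<le> a * a + b * b" using sum_squares_bound[of a b] by (simp add: power2_eq_square)
  then have "2 * a + 1 / b \<le> 2 * b" using ab by (simp add: field_simps)
  with Suc show ?case by (simp add: a_def b_def)
qed simp

section \<open>Pathwise analysis\<close>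

text \<open>A real supremum bounds its members only if the set is bounded above. Cauchy-Schwarz row
  by row provides the Frobenius norm as an upper bound; at the zero vector the quotient is 0 by
  convention.\<close>

lemma L2_set_op_norm_le: "L2_set (\<lambda>l. A l \<bullet> h) {..<k} \<le> op_norm k A * norm h"
proof (cases "h = 0")
  case True then show ?thesis by (simp add: L2_set_def)
next
  case False
  have "L2_set (\<lambda>l. A l \<bullet> u) {..<k} / norm u \<le> L2_set (\<lambda>l. norm (A l)) {..<k}" for u
  proof -
    have "L2_set (\<lambda>l. A l \<bullet> u) {..<k} \<le> L2_set (\<lambda>l. norm (A l) * norm u) {..<k}"
      unfolding L2_set_def
      by (intro real_sqrt_le_mono sum_mono) (metis Cauchy_Schwarz_ineq2 abs_ge_zero power2_abs power_mono)
    also have "\<dots> = L2_set (\<lambda>l. norm (A l)) {..<k} * norm u" by (simp add: L2_set_left_distrib)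
    finally show ?thesis by (cases "u = 0") (auto simp: divide_le_eq)
  qed
  then have "bdd_above (range (\<lambda>h. L2_set (\<lambda>l. A l \<bullet> h) {..<k} / norm h))" by (auto intro!: bdd_aboveI)
  then have "L2_set (\<lambda>l. A l \<bullet> h) {..<k} / norm h \<le> op_norm k A"
    unfolding op_norm_def by (intro cSUP_upper) auto
  with False show ?thesis by (simp add: divide_le_eq)
qed

text \<open>The transposed matrix has the same norm bound, by duality: pair the combination with
  itself and apply Cauchy-Schwarz to the coefficients.\<close>

lemma norm_combination_le: "norm (\<Sum>l<k. v l *\<^sub>R A l) \<le> op_norm k A * L2_set v {..<k}"
proof (cases "(\<Sum>l<k. v l *\<^sub>R A l) = 0")
  case True
  \<comment> \<open>Testing with a vector of norm 1 shows that the operator norm is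
    nonnegative.\<close>
  have "0 \<le> op_norm k A" using L2_set_op_norm_le[of A "axis undefined 1" k] by (simp add: order_trans[OF L2_set_nonneg])
  with True show ?thesis by simp
next
  case False
  define u where "u = (\<Sum>l<k. v l *\<^sub>R A l)"
  have "norm u * norm u = (\<Sum>l<k. v l * (A l \<bullet> u))"
    by (simp add: u_def inner_sum_left flip: power2_eq_square dot_square_norm)
  also have "\<dots> \<le> (\<Sum>l<k. \<bar>v l\<bar> * \<bar>A l \<bullet> u\<bar>)" by (intro sum_mono) (simp flip: abs_mult)
  also have "\<dots> \<le> L2_set v {..<k} * L2_set (\<lambda>l. A l \<bullet> u) {..<k}" by (rule L2_set_mult_ineq)
  also have "\<dots> \<le> L2_set v {..<k} * (op_norm k A * norm u)"
    by (intro mult_left_mono L2_set_op_norm_le) simp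
  finally have "norm u * norm u \<le> (op_norm k A * L2_set v {..<k}) * norm u" by (simp add: ac_simps)
  with False show ?thesis by (simp add: u_def)
qed

text \<open>Jensen's inequality for the squared norm, obtained from the nonnegativity of the
  variance around the barycentre \<open>b\<close>.\<close>

lemma norm_convex_combination_sq_le:
  fixes u :: "'n::finite \<Rightarrow> 'a::real_inner"
  assumes "\<And>j. 0 \<le> a j" "(\<Sum>j\<in>UNIV. a j) = 1"
  shows "(norm (\<Sum>j\<in>UNIV. a j *\<^sub>R u j))\<^sup>2 \<le> (\<Sum>j\<in>UNIV. a j * (norm (u j))\<^sup>2)"
proof -
  define b where "b = (\<Sum>j\<in>UNIV. a j *\<^sub>R u j)"
  have "0 \<le> (\<Sum>j\<in>UNIV. a j * (norm (u j - b))\<^sup>2)" using assms by (intro sum_nonneg) auto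
  also have "\<dots> = (\<Sum>j\<in>UNIV. a j * (norm (u j))\<^sup>2 - 2 * ((a j *\<^sub>R u j) \<bullet> b) + a j * (b \<bullet> b))"
    by (intro sum.cong) (auto simp: power2_norm_eq_inner inner_diff inner_commute algebra_simps)
  also have "\<dots> = (\<Sum>j\<in>UNIV. a j * (norm (u j))\<^sup>2) - 2 * (b \<bullet> b) + (\<Sum>j\<in>UNIV. a j) * (b \<bullet> b)"
    by (simp add: sum.distrib sum_subtractf b_def inner_sum_left flip: sum_distrib_left sum_distrib_right)
  finally show ?thesis using assms by (simp add: b_def power2_norm_eq_inner)
qed

text \<open>The step sizes enter only through positivity, monotonicity and the constant product of
  \<open>\<alpha> t\<close> and \<open>\<gamma> t\<close>. Their explicit formulas are postponed to
  the rates.\<close>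

locale online_problem =
  fixes X :: "(real^'p) set"
    and E :: "nat \<Rightarrow> ('n::finite \<times> 'n) set"
    and W :: "nat \<Rightarrow> real^'n^'n"
    and m :: "'n \<Rightarrow> nat"
    and df :: "'n \<Rightarrow> nat \<Rightarrow> real^'p \<Rightarrow> real^'p"
    and g :: "'n \<Rightarrow> nat \<Rightarrow> real^'p \<Rightarrow> nat \<Rightarrow> real"
    and dg :: "'n \<Rightarrow> nat \<Rightarrow> real^'p \<Rightarrow> nat \<Rightarrow> real^'p"
    and cmp :: "real^'p \<Rightarrow> 'r \<Rightarrow> real^'p"
    and z1 :: "'n \<Rightarrow> real^'p"
    and R G1 G2 L w \<gamma>0 :: real and B :: nat
    and \<alpha> \<gamma> s :: "nat \<Rightarrow> real"
  assumes X: "convex X" "closed X" "\<And>x. x \<in> X \<Longrightarrow> norm x \<le> R"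
    and feasible: "\<And>T. T \<ge> 1 \<Longrightarrow> feasible X m g T \<noteq> {}"
    and df: "\<And>i t x. t \<ge> 1 \<Longrightarrow> x \<in> X \<Longrightarrow> norm (df i t x) \<le> G1"
    and dg: "\<And>i t x k y. t \<ge> 1 \<Longrightarrow> x \<in> X \<Longrightarrow> k < m i \<Longrightarrow> y \<in> X
        \<Longrightarrow> g i t y k \<ge> g i t x k + dg i t x k \<bullet> (y - x)"
    and op_norm_dg: "\<And>i t x. t \<ge> 1 \<Longrightarrow> x \<in> X \<Longrightarrow> op_norm (m i) (dg i t x) \<le> G2"
    and df_Lipschitz: "\<And>i t x y. t \<ge> 1 \<Longrightarrow> x \<in> X \<Longrightarrow> y \<in> X
        \<Longrightarrow> norm (df i t x - df i t y) \<le> L * norm (x - y)"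
    and w: "0 < w" "w < 1"
    and W_weights: "\<And>t i j. t \<ge> 1 \<Longrightarrow> (j, i) \<in> E t \<or> i = j \<Longrightarrow> w \<le> W t $ i $ j"
    and W_stochastic: "\<And>t. t \<ge> 1 \<Longrightarrow> doubly_stochastic (W t)"
    and B: "B > 0" "\<And>t. t \<ge> 1 \<Longrightarrow> strongly_connected (\<Union>l\<in>{0..B - 1}. E (t + l))"
    and \<alpha>: "\<And>t. t \<ge> 1 \<Longrightarrow> 0 < \<alpha> t" "\<And>t. t \<ge> 1 \<Longrightarrow> \<alpha> (Suc t) \<le> \<alpha> t"
    and \<gamma>0: "0 < \<gamma>0" "\<gamma>0 * G2\<^sup>2 \<le> 1 / 4"
    and \<gamma>: "\<And>t. t \<ge> 1 \<Longrightarrow> \<gamma> t = \<gamma>0 / \<alpha> t"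
    and s: "\<And>t. t \<ge> 1 \<Longrightarrow> 0 < s t"
    and z1: "\<And>i. z1 i \<in> X"
begin

definition agents :: real where "agents = real CARD('n)"

lemma sum_agents: "(\<Sum>j\<in>(UNIV :: 'n set). c) = agents * c" by (simp add: agents_def)

lemma agents_pos: "0 < agents" by (simp add: agents_def)

lemma X_nonempty: "X \<noteq> {}" using z1 by auto

lemma proj_mem: "closest_point X u \<in> X"
  by (rule closest_point_in_set[OF X(2) X_nonempty])

lemma proj_dist: "y \<in> X \<Longrightarrow> norm (closest_point X u - y) \<le> norm (u - y)"
  using closest_point_lipschitz[OF X(1,2) X_nonempty, of u y] by (simp add: dist_norm closest_point_self)

lemma R_nonneg: "0 \<le> R" using X(3)[OF z1] norm_ge_zero order_trans by blast

lemma G1_nonneg: "0 \<le> G1" using df[OF _ z1, of 1] norm_ge_zero order_trans by blast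

lemma norm_diff_le: "u \<in> X \<Longrightarrow> y \<in> X \<Longrightarrow> norm (u - y) \<le> 2 * R"
  using norm_triangle_ineq4[of u y] X(3)[of u] X(3)[of y] by simp

lemma W_row: "t \<ge> 1 \<Longrightarrow> row_stochastic (W t)"
  using W_stochastic by (simp add: doubly_stochastic_def row_stochastic_def)

lemma G2_nonneg: "0 \<le> G2"
proof -
  fix i :: 'n
  have "0 \<le> op_norm (m i) (dg i 1 (z1 i))"
    using L2_set_op_norm_le[of "dg i 1 (z1 i)" "axis undefined 1" "m i"]
    by (simp add: order_trans[OF L2_set_nonneg])
  with op_norm_dg[OF _ z1, of 1 i i] show ?thesis by simp
qed

lemma dg_combination: "t \<ge> 1 \<Longrightarrow> u \<in> X \<Longrightarrow> norm (\<Sum>k<m i. c k *\<^sub>R dg i t u k) \<le> G2 * L2_set c {..<m i}"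
  by (rule order_trans[OF norm_combination_le]) (intro mult_right_mono op_norm_dg, auto)

definition viol :: "'n \<Rightarrow> nat \<Rightarrow> real^'p \<Rightarrow> real" where
  "viol j t u = L2_set (\<lambda>k. max 0 (g j t u k)) {..<m j}"

lemma viol_nonneg: "0 \<le> viol j t u" by (simp add: viol_def)

text \<open>Cumulative violation tests the point of agent \<open>i\<close> on the constraint of
  agent \<open>j\<close>, whereas the algorithm controls each agent only on its own constraint. This
  estimate transfers between the two points at the price of their distance.\<close>

lemma viol_Lipschitz:
  assumes "t \<ge> 1" "u \<in> X" "y \<in> X"
  shows "viol j t u \<le> viol j t y + G2 * norm (u - y)"
proof -
  have "viol j t u \<le> L2_set (\<lambda>k. max 0 (g j t y k) + \<bar>dg j t u k \<bullet> (u - y)\<bar>) {..<m j}"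
    unfolding viol_def
  proof (intro L2_set_mono)
    fix k assume "k \<in> {..<m j}"
    then have "g j t u k + dg j t u k \<bullet> (y - u) \<le> g j t y k" using dg assms by auto
    then show "max 0 (g j t u k) \<le> max 0 (g j t y k) + \<bar>dg j t u k \<bullet> (u - y)\<bar>"
      by (auto simp: inner_diff_right max_def)
  qed simp
  also have "\<dots> \<le> viol j t y + L2_set (\<lambda>k. \<bar>dg j t u k \<bullet> (u - y)\<bar>) {..<m j}"
    unfolding viol_def by (rule L2_set_triangle_ineq)
  also have "L2_set (\<lambda>k. \<bar>dg j t u k \<bullet> (u - y)\<bar>) {..<m j} = L2_set (\<lambda>k. dg j t u k \<bullet> (u - y)) {..<m j}"
    by (simp add: L2_set_def)
  also have "\<dots> \<le> op_norm (m j) (dg j t u) * norm (u - y)" by (rule L2_set_op_norm_le)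
  also have "\<dots> \<le> G2 * norm (u - y)" using op_norm_dg assms by (intro mult_right_mono) auto
  finally show ?thesis by simp
qed

lemma norm_direction_le:
  assumes t: "t \<ge> 1" and u: "u \<in> X"
    and c: "\<And>k. k < m j \<Longrightarrow> c k = \<gamma> t * max 0 (g j t u k)"
    and \<omega>: "\<omega> = df j t u + (\<Sum>k<m j. c k *\<^sub>R dg j t u k)"
  shows "\<alpha> t * norm \<omega> \<le> \<alpha> t * G1 + \<gamma>0 * G2 * viol j t u"
proof -
  have pos: "0 < \<alpha> t" "0 < \<gamma> t" "\<alpha> t * \<gamma> t = \<gamma>0" using \<alpha>(1)[OF t] \<gamma>[OF t] \<gamma>0 by auto
  have "L2_set c {..<m j} = \<gamma> t * viol j t u"
    unfolding viol_def using pos c by (auto simp: L2_set_right_distrib intro!: L2_set_cong)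
  then have "norm \<omega> \<le> G1 + G2 * (\<gamma> t * viol j t u)"
    unfolding \<omega> using df[OF t u, of j] dg_combination[OF t u, of c j] by (metis add_mono norm_triangle_le)
  then have "\<alpha> t * norm \<omega> \<le> \<alpha> t * (G1 + G2 * (\<gamma> t * viol j t u))" using pos by (intro mult_left_mono) auto
  also have "\<dots> = \<alpha> t * G1 + (\<alpha> t * \<gamma> t) * G2 * viol j t u" by (simp add: algebra_simps)
  finally show ?thesis by (simp add: pos)
qed

lemma step_displacement:
  assumes t: "t \<ge> 1" and u: "u \<in> X"
    and c: "\<And>k. k < m j \<Longrightarrow> c k = \<gamma> t * max 0 (g j t u k)"
    and \<omega>: "\<omega> = df j t u + (\<Sum>k<m j. c k *\<^sub>R dg j t u k)"
  shows "norm (closest_point X (u - \<alpha> t *\<^sub>R \<omega>) - u) \<le> \<alpha> t * G1 + \<gamma>0 * G2 * viol j t u"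
  using proj_dist[OF u, of "u - \<alpha> t *\<^sub>R \<omega>"] norm_direction_le[OF assms] \<alpha>(1)[OF t] by simp

text \<open>Of the \<open>2 * \<gamma>0\<close> squared violations gained from the dual term, the
  squared step length consumes at most one half \<open>\<gamma>0\<close>, which leaves 3/2. The
  parameter \<sigma> treats a feasible point (\<sigma> = 0) and a Slater point at once.\<close>

lemma step_descent:
  assumes t: "t \<ge> 1" and u: "u \<in> X" and y: "y \<in> X"
    and \<sigma>: "0 \<le> \<sigma>" "\<And>k. k < m j \<Longrightarrow> g j t y k \<le> - \<sigma>"
    and c: "\<And>k. k < m j \<Longrightarrow> c k = \<gamma> t * max 0 (g j t u k)"
    and \<omega>: "\<omega> = df j t u + (\<Sum>k<m j. c k *\<^sub>R dg j t u k)"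
    and z': "z' = closest_point X (u - \<alpha> t *\<^sub>R \<omega>)"
  shows "2 * \<alpha> t * (df j t u \<bullet> (u - y)) + 3 / 2 * \<gamma>0 * (viol j t u)\<^sup>2 + 2 * \<gamma>0 * \<sigma> * viol j t u
      \<le> (norm (u - y))\<^sup>2 - (norm (z' - y))\<^sup>2 + 2 * (\<alpha> t)\<^sup>2 * G1\<^sup>2"
proof -
  define q where "q = viol j t u"
  have q: "0 \<le> q" by (simp add: q_def viol_nonneg)
  have pos: "0 < \<alpha> t" "0 < \<gamma> t" "\<alpha> t * \<gamma> t = \<gamma>0" using \<alpha>(1)[OF t] \<gamma>[OF t] \<gamma>0 by auto
  have disp: "\<alpha> t * norm \<omega> \<le> \<alpha> t * G1 + \<gamma>0 * G2 * q"
    unfolding q_def by (rule norm_direction_le[OF t u c \<omega>])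

  have "(\<alpha> t * norm \<omega>)\<^sup>2 \<le> (\<alpha> t * G1 + \<gamma>0 * G2 * q)\<^sup>2" using disp pos by (intro power_mono) auto
  also have "\<dots> \<le> 2 * (\<alpha> t * G1)\<^sup>2 + 2 * (\<gamma>0 * G2 * q)\<^sup>2"
    using sum_squares_bound[of "\<alpha> t * G1" "\<gamma>0 * G2 * q"] by (simp add: power2_sum)
  \<comment> \<open>One factor \<gamma>0 is kept and the other is spent on \<open>G2\<close>
    squared; this is what the upper bound on \<gamma>0 is designed for.\<close>
  also have "(\<gamma>0 * G2 * q)\<^sup>2 = \<gamma>0 * (\<gamma>0 * G2\<^sup>2) * q\<^sup>2" by (simp add: power2_eq_square)
  also have "\<dots> \<le> \<gamma>0 * (1 / 4) * q\<^sup>2" using \<gamma>0 by (intro mult_right_mono mult_left_mono) auto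
  finally have sq: "(\<alpha> t)\<^sup>2 * (norm \<omega>)\<^sup>2 \<le> 2 * (\<alpha> t)\<^sup>2 * G1\<^sup>2 + \<gamma>0 * q\<^sup>2 / 2"
    by (simp add: power_mult_distrib)

  have "\<gamma> t * q\<^sup>2 + \<gamma> t * \<sigma> * q \<le> (\<Sum>k<m j. \<gamma> t * (max 0 (g j t u k))\<^sup>2) + (\<Sum>k<m j. \<gamma> t * \<sigma> * max 0 (g j t u k))"
  proof -
    have "q \<le> (\<Sum>k<m j. max 0 (g j t u k))" unfolding q_def viol_def by (rule L2_set_le_sum) simp
    then have "\<gamma> t * \<sigma> * q \<le> \<gamma> t * \<sigma> * (\<Sum>k<m j. max 0 (g j t u k))"
      using pos \<sigma> by (intro mult_left_mono) auto
    moreover have "q\<^sup>2 = (\<Sum>k<m j. (max 0 (g j t u k))\<^sup>2)" by (simp add: q_def viol_def L2_set_def sum_nonneg)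
    ultimately show ?thesis by (simp add: sum_distrib_left)
  qed
  also have "\<dots> \<le> (\<Sum>k<m j. c k * (dg j t u k \<bullet> (u - y)))"
    unfolding sum.distrib[symmetric]
  proof (intro sum_mono)
    fix k assume "k \<in> {..<m j}"
    then have k: "k < m j" by simp
    \<comment> \<open>Convexity gives \<open>g j t u k + \<sigma>\<close> at most the inner product
      on the right. The positive part is a nonnegative multiplier, and it turns
      \<open>g j t u k\<close> into a square.\<close>
    have "max 0 (g j t u k) * (g j t u k + \<sigma>) \<le> max 0 (g j t u k) * (dg j t u k \<bullet> (u - y))"
      using dg[OF t u k y] \<sigma>(2)[OF k] by (intro mult_left_mono) (auto simp: inner_diff_right)
    then have "\<gamma> t * (max 0 (g j t u k) * (g j t u k + \<sigma>)) \<le> \<gamma> t * (max 0 (g j t u k) * (dg j t u k \<bullet> (u - y)))"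
      by (rule mult_left_mono) (use pos in simp)
    moreover have "max 0 (g j t u k) * g j t u k = (max 0 (g j t u k))\<^sup>2" by (auto simp: max_def power2_eq_square)
    ultimately show "\<gamma> t * (max 0 (g j t u k))\<^sup>2 + \<gamma> t * \<sigma> * max 0 (g j t u k) \<le> c k * (dg j t u k \<bullet> (u - y))"
      by (simp add: c[OF k] algebra_simps)
  qed
  also have "\<dots> = \<omega> \<bullet> (u - y) - df j t u \<bullet> (u - y)" by (simp add: \<omega> inner_add_left inner_sum_left)
  finally have "2 * \<alpha> t * (\<gamma> t * q\<^sup>2 + \<gamma> t * \<sigma> * q) \<le> 2 * \<alpha> t * (\<omega> \<bullet> (u - y) - df j t u \<bullet> (u - y))"
    using pos by (intro mult_left_mono) auto
  moreover have "2 * \<alpha> t * (\<gamma> t * q\<^sup>2 + \<gamma> t * \<sigma> * q) = 2 * (\<alpha> t * \<gamma> t) * (q\<^sup>2 + \<sigma> * q)" by (simp add: algebra_simps)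
  ultimately have inner: "2 * \<gamma>0 * q\<^sup>2 + 2 * \<gamma>0 * \<sigma> * q + 2 * \<alpha> t * (df j t u \<bullet> (u - y)) \<le> 2 * \<alpha> t * (\<omega> \<bullet> (u - y))"
    by (simp add: pos algebra_simps)

  have "(norm (z' - y))\<^sup>2 \<le> (norm (u - \<alpha> t *\<^sub>R \<omega> - y))\<^sup>2"
    unfolding z' by (intro power_mono proj_dist y) auto
  also have "\<dots> = (norm (u - y))\<^sup>2 - 2 * \<alpha> t * (\<omega> \<bullet> (u - y)) + (\<alpha> t)\<^sup>2 * (norm \<omega>)\<^sup>2"
    unfolding power2_norm_eq_inner by (simp add: inner_diff inner_commute power2_eq_square algebra_simps)
  finally show "2 * \<alpha> t * (df j t u \<bullet> (u - y)) + 3 / 2 * \<gamma>0 * (viol j t u)\<^sup>2 + 2 * \<gamma>0 * \<sigma> * viol j t u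
      \<le> (norm (u - y))\<^sup>2 - (norm (z' - y))\<^sup>2 + 2 * (\<alpha> t)\<^sup>2 * G1\<^sup>2"
    using sq inner unfolding q_def by linarith
qed

text \<open>With \<open>N = CARD('n) * B\<close>, the contraction loss is \<open>w ^ N\<close>. The
  term \<open>R\<close> comes from the diameter bound \<open>2 * R\<close> on the first
  \<open>N\<close> times, and \<open>1 + G1 + \<gamma>0 * G2\<close> dominates the coefficients of
  the perturbations.\<close>

definition consensus_const :: real where
  "consensus_const = 2 * real (CARD('n) * B) * (R + 1 + G1 + \<gamma>0 * G2) / w ^ (CARD('n) * B)"

lemma consensus_const_nonneg: "0 \<le> consensus_const"
  unfolding consensus_const_def using R_nonneg G1_nonneg G2_nonneg \<gamma>0 w by simp

text \<open>The first factor is the price in regret of one unit of disagreement: the change of the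
  gradient times the diameter, plus the gradient times the displacement. The absolute value is there
  because the sign of \<open>L\<close> is not prescribed.\<close>

definition regret_const :: real where
  "regret_const = (2 * R * \<bar>L\<bar> + G1) * consensus_const"

end

section \<open>Estimates along one trajectory, for a fixed realization of the compressor\<close>

locale online_run = online_problem X E W m df g dg cmp z1 R G1 G2 L w \<gamma>0 B \<alpha> \<gamma> s
  for X :: "(real^'p) set"
    and E :: "nat \<Rightarrow> ('n::finite \<times> 'n) set"
    and W m df g dg and cmp :: "real^'p \<Rightarrow> 'r \<Rightarrow> real^'p" and z1 R G1 G2 L w \<gamma>0 B \<alpha> \<gamma> s +
  fixes \<xi> z zhat x v \<omega>
  assumes run: "algorithm_run X W m df g dg cmp \<alpha> \<gamma> s z1 \<xi> z zhat x v \<omega>"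
begin

lemma run_zhat: "t \<ge> 1 \<Longrightarrow> zhat i t = closest_point X
    (zhat i (t - 1) + s t *\<^sub>R cmp ((1 / s t) *\<^sub>R (z i t - zhat i (t - 1))) (\<xi> i t))"
  and run_x: "t \<ge> 1 \<Longrightarrow> x i t = (\<Sum>j\<in>UNIV. (W t $ i $ j) *\<^sub>R zhat j t)"
  and run_v: "t \<ge> 1 \<Longrightarrow> k < m i \<Longrightarrow> v i (t + 1) k = \<gamma> t * max 0 (g i t (x i t) k)"
  and run_\<omega>: "t \<ge> 1 \<Longrightarrow> \<omega> i (t + 1) = df i t (x i t) + (\<Sum>k<m i. v i (t + 1) k *\<^sub>R dg i t (x i t) k)"
  and run_z: "t \<ge> 1 \<Longrightarrow> z i (t + 1) = closest_point X (x i t - \<alpha> t *\<^sub>R \<omega> i (t + 1))"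
  and run_z1: "z i 1 = z1 i" and run_zhat0: "zhat i 0 = 0"
  using run unfolding algorithm_run_def by blast+

lemma zhat_mem: "t \<ge> 1 \<Longrightarrow> zhat i t \<in> X" by (simp only: run_zhat proj_mem)

lemma x_mem: "t \<ge> 1 \<Longrightarrow> x i t \<in> X"
  unfolding run_x using W_row[of t] by (intro convex_sum X) (auto simp: row_stochastic_def zhat_mem)

lemma z_mem: "t \<ge> 1 \<Longrightarrow> z i t \<in> X"
proof (induction t rule: dec_induct)
  case base show ?case by (simp only: run_z1 z1)
next
  case (step t) then show ?case using run_z[of t i] proj_mem by simp
qed

definition \<delta> :: "nat \<Rightarrow> real" where "\<delta> t = (\<Sum>j\<in>UNIV. norm (zhat j t - z j t))"
definition Q :: "nat \<Rightarrow> real" where "Q t = (\<Sum>j\<in>UNIV. viol j t (x j t))"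
definition QQ :: "nat \<Rightarrow> real" where "QQ t = (\<Sum>j\<in>UNIV. (viol j t (x j t))\<^sup>2)"
definition V where "V y t = (\<Sum>j\<in>UNIV. (norm (z j t - y))\<^sup>2)"

lemma \<delta>_nonneg: "0 \<le> \<delta> t" by (simp add: \<delta>_def sum_nonneg)
lemma Q_nonneg: "0 \<le> Q t" by (simp add: Q_def sum_nonneg viol_nonneg)
lemma QQ_nonneg: "0 \<le> QQ t" by (simp add: QQ_def sum_nonneg)

lemma V_nonneg: "0 \<le> V y t" by (simp add: V_def sum_nonneg)

lemma V_le: "t \<ge> 1 \<Longrightarrow> y \<in> X \<Longrightarrow> V y t \<le> 4 * agents * R\<^sup>2"
proof -
  assume "t \<ge> 1" "y \<in> X"
  then have "V y t \<le> (\<Sum>j\<in>(UNIV::'n set). (2 * R)\<^sup>2)"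
    unfolding V_def by (intro sum_mono power_mono norm_diff_le z_mem) auto
  then show ?thesis by (simp add: agents_def power_mult_distrib)
qed

text \<open>Jensen uses the row sums; after exchanging the sums, the column sums show that mixing
  does not increase the total squared distance to \<open>y\<close>. Passing from \<open>zhat\<close>
  to \<open>z\<close> factors a difference of squares, whose second factor is at most
  \<open>4 * R\<close>.\<close>

lemma sum_dist_x_le:
  assumes t: "t \<ge> 1" and y: "y \<in> X"
  shows "(\<Sum>i\<in>UNIV. (norm (x i t - y))\<^sup>2) \<le> V y t + 4 * R * \<delta> t"
proof -
  have W: "0 \<le> W t $ i $ j" "(\<Sum>j\<in>UNIV. W t $ i $ j) = 1" "(\<Sum>i\<in>UNIV. W t $ i $ j) = 1" for i j
    using W_stochastic[OF t] by (auto simp: doubly_stochastic_def)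
  have "(norm (x i t - y))\<^sup>2 \<le> (\<Sum>j\<in>UNIV. W t $ i $ j * (norm (zhat j t - y))\<^sup>2)" for i
  proof -
    have "x i t - y = (\<Sum>j\<in>UNIV. W t $ i $ j *\<^sub>R (zhat j t - y))"
      by (simp add: run_x[OF t] scaleR_diff_right sum_subtractf W flip: scaleR_sum_left)
    then show ?thesis by (simp add: norm_convex_combination_sq_le W)
  qed
  then have "(\<Sum>i\<in>UNIV. (norm (x i t - y))\<^sup>2) \<le> (\<Sum>i\<in>UNIV. \<Sum>j\<in>UNIV. W t $ i $ j * (norm (zhat j t - y))\<^sup>2)"
    by (intro sum_mono)
  also have "\<dots> = (\<Sum>j\<in>UNIV. (norm (zhat j t - y))\<^sup>2)"
    by (subst sum.swap) (simp add: W flip: sum_distrib_right)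
  also have "\<dots> \<le> (\<Sum>j\<in>UNIV. (norm (z j t - y))\<^sup>2 + 4 * R * norm (zhat j t - z j t))"
  proof (intro sum_mono)
    fix j
    define a b where "a = norm (zhat j t - y)" and "b = norm (z j t - y)"
    have "a - b \<le> norm (zhat j t - z j t)"
      using norm_triangle_ineq2[of "zhat j t - y" "z j t - y"] by (simp add: a_def b_def)
    moreover have "a \<le> 2 * R" "b \<le> 2 * R" "0 \<le> a" "0 \<le> b"
      using t y by (auto simp: a_def b_def norm_diff_le zhat_mem z_mem)
    ultimately have "(a - b) * (a + b) \<le> norm (zhat j t - z j t) * (4 * R)"
      by (intro mult_mono) auto
    then show "a\<^sup>2 \<le> b\<^sup>2 + 4 * R * norm (zhat j t - z j t)"
      by (simp add: power2_eq_square algebra_simps)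
  qed
  finally show ?thesis by (simp add: V_def \<delta>_def sum.distrib sum_distrib_left)
qed

lemma descent:
  assumes t: "t \<ge> 1" and y: "y \<in> X"
    and \<sigma>: "0 \<le> \<sigma>" "\<And>j k. k < m j \<Longrightarrow> g j t y k \<le> - \<sigma>"
  shows "2 * \<alpha> t * (\<Sum>j\<in>UNIV. df j t (x j t) \<bullet> (x j t - y)) + 3 / 2 * \<gamma>0 * QQ t + 2 * \<gamma>0 * \<sigma> * Q t
      \<le> V y t - V y (Suc t) + 4 * R * \<delta> t + 2 * agents * (\<alpha> t)\<^sup>2 * G1\<^sup>2"
proof -
  have "2 * \<alpha> t * (\<Sum>j\<in>UNIV. df j t (x j t) \<bullet> (x j t - y)) + 3 / 2 * \<gamma>0 * QQ t + 2 * \<gamma>0 * \<sigma> * Q t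
    = (\<Sum>j\<in>UNIV. 2 * \<alpha> t * (df j t (x j t) \<bullet> (x j t - y)) + 3 / 2 * \<gamma>0 * (viol j t (x j t))\<^sup>2
        + 2 * \<gamma>0 * \<sigma> * viol j t (x j t))"
    by (simp add: QQ_def Q_def sum.distrib sum_distrib_left)
  also have "\<dots> \<le> (\<Sum>j\<in>UNIV. (norm (x j t - y))\<^sup>2 - (norm (z j (t + 1) - y))\<^sup>2 + 2 * (\<alpha> t)\<^sup>2 * G1\<^sup>2)"
    by (intro sum_mono step_descent[OF t x_mem[OF t] y \<sigma>(1) \<sigma>(2) run_v[OF t] run_\<omega>[OF t] run_z[OF t]])
  also have "\<dots> = (\<Sum>j\<in>UNIV. (norm (x j t - y))\<^sup>2) - V y (Suc t) + 2 * agents * (\<alpha> t)\<^sup>2 * G1\<^sup>2"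
    by (simp add: sum.distrib sum_subtractf V_def agents_def)
  finally show ?thesis using sum_dist_x_le[OF t y] by simp
qed

lemma abs_df_inner_le:
  assumes "t \<ge> 1" "u \<in> X" "y \<in> X"
  shows "\<bar>df j t u \<bullet> (u - y)\<bar> \<le> G1 * (2 * R)"
  using assms df[of t u j] norm_diff_le[of u y] G1_nonneg
  by (intro order_trans[OF Cauchy_Schwarz_ineq2] mult_mono) auto

text \<open>The gradient term has no useful sign, but \<open>\<alpha> t\<close> multiplies it, so a
  crude bound by \<open>G1 * (2 * R)\<close> per agent is affordable. The coefficients 3/2 and 2 of
  the descent inequality are relaxed to 1.\<close>

lemma sum_violation_le:
  assumes y: "y \<in> X" and \<sigma>: "0 \<le> \<sigma>" "\<And>t j k. t \<in> {1..T} \<Longrightarrow> k < m j \<Longrightarrow> g j t y k \<le> - \<sigma>"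
  shows "(\<Sum>t=1..T. \<gamma>0 * QQ t + \<gamma>0 * \<sigma> * Q t)
    \<le> 4 * agents * R\<^sup>2 + (\<Sum>t=1..T. 4 * R * \<delta> t + 2 * agents * (\<alpha> t)\<^sup>2 * G1\<^sup>2 + 4 * agents * R * G1 * \<alpha> t)"
proof (cases "T \<ge> 1")
  case True
  have "\<gamma>0 * QQ t + \<gamma>0 * \<sigma> * Q t \<le> 1 * (V y t - V y (Suc t))
      + (4 * R * \<delta> t + 2 * agents * (\<alpha> t)\<^sup>2 * G1\<^sup>2 + 4 * agents * R * G1 * \<alpha> t)"
    if t: "t \<in> {1..T}" for t
  proof -
    have t1: "t \<ge> 1" using t by simp
    have "(\<Sum>j\<in>(UNIV :: 'n set). - (G1 * (2 * R))) \<le> (\<Sum>j\<in>UNIV. df j t (x j t) \<bullet> (x j t - y))"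
      using abs_df_inner_le[OF t1 x_mem[OF t1] y] by (intro sum_mono) (metis abs_le_D2 minus_le_iff)
    then have "\<alpha> t * (- (agents * (G1 * (2 * R)))) \<le> \<alpha> t * (\<Sum>j\<in>UNIV. df j t (x j t) \<bullet> (x j t - y))"
      using \<alpha>(1)[OF t1] by (intro mult_left_mono) (simp_all add: agents_def)
    moreover have "\<gamma>0 * QQ t \<ge> 0" "\<gamma>0 * \<sigma> * Q t \<ge> 0" using \<gamma>0 \<sigma> QQ_nonneg Q_nonneg by auto
    ultimately show ?thesis using descent[OF t1 y \<sigma>(1) \<sigma>(2)[OF t]] by (simp add: algebra_simps)
  qed
  then have "(\<Sum>t=1..T. \<gamma>0 * QQ t + \<gamma>0 * \<sigma> * Q t) \<le> (\<Sum>t=1..T. 1 * (V y t - V y (Suc t))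
      + (4 * R * \<delta> t + 2 * agents * (\<alpha> t)\<^sup>2 * G1\<^sup>2 + 4 * agents * R * G1 * \<alpha> t))"
    by (intro sum_mono)
  moreover have "(\<Sum>t=1..T. 1 * (V y t - V y (Suc t))) \<le> 1 * (4 * agents * R\<^sup>2)"
    by (rule abel_bound[where V="V y" and b="\<lambda>_. 1"]) (use True in \<open>auto simp: V_nonneg V_le y\<close>)
  ultimately show ?thesis unfolding sum.distrib by simp
next
  case False
  then show ?thesis using agents_pos by simp
qed

section \<open>Disagreement, cumulative violation and regret of a trajectory\<close>

definition spr :: "nat \<Rightarrow> real" where "spr t = spread (\<lambda>i. x i t)"

lemma spr_nonneg: "0 \<le> spr t" by (simp add: spr_def spread_nonneg)

lemma norm_x_diff_le: "norm (x i t - x j t) \<le> spr t"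
  unfolding spr_def by (rule norm_diff_le_spread[of "\<lambda>i. x i t"])

lemma sum_spr_le: "(\<Sum>t=1..T. spr t) \<le> consensus_const * (1 + (\<Sum>t=1..T. \<alpha> t + \<delta> t + Q t))"
proof -
  define N where "N = CARD('n) * B"
  define \<eta> where "\<eta> = w ^ N"
  have \<eta>: "0 < \<eta>" "\<eta> \<le> 1" using w by (auto simp: \<eta>_def power_le_one)
  \<comment> \<open>Between \<open>x j (t - 1)\<close> and \<open>zhat j t\<close> lie the
    primal-dual step of time \<open>t - 1\<close> and the compression error of time
    \<open>t\<close>. The case distinction keeps the unconstrained value \<open>\<alpha> 0\<close>
    out.\<close>
  define \<pi> where "\<pi> t = \<delta> t + (if t \<ge> 2 then \<alpha> (t - 1) * G1 + \<gamma>0 * G2 * Q (t - 1) else 0)" for t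
  have \<pi>_nonneg: "0 \<le> \<pi> t" for t
    using less_imp_le[OF \<alpha>(1)[of "t - 1"]] G1_nonneg G2_nonneg \<gamma>0 Q_nonneg \<delta>_nonneg
    by (auto simp: \<pi>_def intro!: add_nonneg_nonneg mult_nonneg_nonneg)
  have step: "spr (t + N) \<le> (1 - \<eta>) * spr t + 2 * (\<Sum>k\<in>{1..N}. \<pi> (t + k))" if t: "t \<ge> 1" for t
  proof -
    \<comment> \<open>With this perturbation the update of \<open>x\<close> reads as mixing of the
      previous \<open>x\<close> plus \<open>p\<close>, the form required by
      \<open>spread_perturbed\<close>.\<close>
    define p where "p k j = zhat j k - x j (k - 1)" for k j
    show ?thesis unfolding spr_def
    proof (rule spread_perturbed[where W=W and p=p and x="\<lambda>t i. x i t"])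
      show "row_stochastic (W t)" if "t \<ge> 1" for t by (rule W_row[OF that])
      show "(\<lambda>i. x i (Suc k)) = mix (W (Suc k)) (\<lambda>j. x j k + p (Suc k) j)" if "k \<ge> t" for k
        by (rule ext) (simp add: p_def mix_def run_x)
      show "\<eta> \<le> transition W t N $ i $ j" for i j
        unfolding \<eta>_def N_def by (rule transition_lower_bound[OF w(1) W_weights W_row B])
      fix k j assume k: "k > t"
      define l where "l = k - 1"
      have l: "l \<ge> 1" "k = l + 1" using k t by (auto simp: l_def)
      have "norm (p k j) \<le> norm (zhat j k - z j k) + norm (z j k - x j l)"
        using norm_triangle_ineq[of "zhat j k - z j k" "z j k - x j l"] by (simp add: p_def l)
      also have "norm (zhat j k - z j k) \<le> \<delta> k" unfolding \<delta>_def by (intro member_le_sum) auto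
      also have "norm (z j k - x j l) \<le> \<alpha> l * G1 + \<gamma>0 * G2 * viol j l (x j l)"
        unfolding l(2) run_z[OF l(1)] by (rule step_displacement[OF l(1) x_mem[OF l(1)] run_v[OF l(1)] run_\<omega>[OF l(1)]])
      also have "viol j l (x j l) \<le> Q l" unfolding Q_def by (intro member_le_sum viol_nonneg) auto
      finally show "norm (p k j) \<le> \<pi> k"
        using l \<gamma>0 G2_nonneg by (simp add: \<pi>_def mult_left_mono)
    qed
  qed
  have contraction: "\<eta> * (\<Sum>t=1..T. spr t) \<le> real N * (2 * R) + 2 * real N * (\<Sum>t=1..T. \<pi> t)"
  proof (rule sum_contraction)
    show "spr t \<le> 2 * R" if "t \<ge> 1" for t
      unfolding spr_def by (intro spread_le norm_diff_le x_mem that)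
  qed (use \<eta> \<pi>_nonneg step in \<open>auto simp: spr_nonneg\<close>)
  have "(\<Sum>t=1..T. \<pi> t) \<le> (\<Sum>t=1..T. \<delta> t + \<alpha> t * G1 + \<gamma>0 * G2 * Q t)"
  proof -
    define a where "a t = \<alpha> t * G1 + \<gamma>0 * G2 * Q t" for t
    have a: "0 \<le> a t" if "t \<ge> 1" for t
      using less_imp_le[OF \<alpha>(1)[OF that]] G1_nonneg G2_nonneg \<gamma>0 Q_nonneg
      by (auto simp: a_def intro!: add_nonneg_nonneg mult_nonneg_nonneg)
    \<comment> \<open>The shift by one in time is removed by reindexing; the last step, of time
      \<open>T\<close>, is then added for free.\<close>
    have "(\<Sum>t=1..T. if t \<ge> 2 then a (t - 1) else 0) = (\<Sum>t\<in>Suc ` {1..<T}. a (t - 1))"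
    proof (rule sum.mono_neutral_cong_right)
      show "\<forall>t\<in>{1..T} - Suc ` {1..<T}. (if t \<ge> 2 then a (t - 1) else 0) = 0"
      proof
        fix t assume t: "t \<in> {1..T} - Suc ` {1..<T}"
        have "t - 1 \<in> {1..<T}" if "t \<ge> 2" using that t by auto
        then have "\<not> t \<ge> 2" using t image_eqI[of t Suc "t - 1" "{1..<T}"] by auto
        then show "(if t \<ge> 2 then a (t - 1) else 0) = 0" by simp
      qed
    qed auto
    also have "\<dots> = (\<Sum>t\<in>{1..<T}. a t)" by (subst sum.reindex) auto
    also have "\<dots> \<le> (\<Sum>t=1..T. a t)" using a by (intro sum_mono2) auto
    finally have "(\<Sum>t=1..T. if t \<ge> 2 then a (t - 1) else 0) \<le> (\<Sum>t=1..T. a t)" .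
    moreover have "\<pi> t = \<delta> t + (if t \<ge> 2 then a (t - 1) else 0)" for t by (simp add: \<pi>_def a_def)
    ultimately have "(\<Sum>t=1..T. \<pi> t) \<le> (\<Sum>t=1..T. \<delta> t + a t)" by (simp add: sum.distrib)
    then show ?thesis by (simp only: a_def add.assoc)
  qed
  also have "\<dots> \<le> (\<Sum>t=1..T. (1 + G1 + \<gamma>0 * G2) * (\<alpha> t + \<delta> t + Q t))"
  proof (intro sum_mono)
    fix t assume "t \<in> {1..T}"
    then have "0 \<le> \<alpha> t" using \<alpha>(1)[of t] by auto
    then have "0 \<le> G1 * (\<delta> t + Q t)" "0 \<le> \<gamma>0 * G2 * (\<alpha> t + \<delta> t)" "0 \<le> \<alpha> t + Q t"
      using G1_nonneg G2_nonneg \<gamma>0 Q_nonneg[of t] \<delta>_nonneg[of t] by auto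
    then show "\<delta> t + \<alpha> t * G1 + \<gamma>0 * G2 * Q t \<le> (1 + G1 + \<gamma>0 * G2) * (\<alpha> t + \<delta> t + Q t)"
      by (simp add: algebra_simps)
  qed
  finally have "2 * real N * (\<Sum>t=1..T. \<pi> t) \<le> 2 * real N * (\<Sum>t=1..T. (1 + G1 + \<gamma>0 * G2) * (\<alpha> t + \<delta> t + Q t))"
    by (intro mult_left_mono) auto
  with contraction have "\<eta> * (\<Sum>t=1..T. spr t)
      \<le> real N * (2 * R) + 2 * real N * (\<Sum>t=1..T. (1 + G1 + \<gamma>0 * G2) * (\<alpha> t + \<delta> t + Q t))" by linarith
  also have "real N * (2 * R) + 2 * real N * (\<Sum>t=1..T. (1 + G1 + \<gamma>0 * G2) * (\<alpha> t + \<delta> t + Q t))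
    \<le> \<eta> * (consensus_const * (1 + (\<Sum>t=1..T. \<alpha> t + \<delta> t + Q t)))"
  proof -
    define S where "S = (\<Sum>t=1..T. \<alpha> t + \<delta> t + Q t)"
    have S: "0 \<le> S" unfolding S_def
      using \<alpha>(1) Q_nonneg \<delta>_nonneg by (intro sum_nonneg add_nonneg_nonneg) (auto simp: less_imp_le)
    have "\<eta> * consensus_const = 2 * real N * (R + 1 + G1 + \<gamma>0 * G2)"
      using w by (simp add: consensus_const_def N_def \<eta>_def)
    then have "\<eta> * (consensus_const * (1 + S)) = 2 * real N * (R + 1 + G1 + \<gamma>0 * G2) * (1 + S)"
      by (simp flip: mult.assoc)
    moreover have "0 \<le> real N * (R * S)" "0 \<le> real N * (1 + G1 + \<gamma>0 * G2)"
      using R_nonneg S G1_nonneg G2_nonneg \<gamma>0 by auto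
    ultimately show ?thesis
      unfolding S_def[symmetric] sum_distrib_left[symmetric] by (simp add: algebra_simps)
  qed
  finally show ?thesis using \<eta> by simp
qed

lemma net_ccv_le:
  "net_ccv m g x T \<le> (1 + agents * G2 * consensus_const) * (1 + (\<Sum>t=1..T. \<alpha> t + \<delta> t + Q t))"
proof -
  have "L2_set (\<lambda>(j, k). max 0 (g j t (x i t) k)) (SIGMA j:UNIV. {..<m j}) \<le> Q t + agents * G2 * spr t"
    if "t \<in> {1..T}" for i t
  proof -
    have t: "t \<ge> 1" using that by simp
    have "L2_set (\<lambda>(j, k). max 0 (g j t (x i t) k)) (SIGMA j:UNIV. {..<m j})
        = L2_set (\<lambda>j. viol j t (x i t)) UNIV"
      by (simp add: L2_set_def viol_def sum.Sigma sum_nonneg case_prod_unfold)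
    also have "\<dots> \<le> (\<Sum>j\<in>UNIV. viol j t (x i t))" by (rule L2_set_le_sum) (simp add: viol_nonneg)
    also have "\<dots> \<le> (\<Sum>j\<in>UNIV. viol j t (x j t) + G2 * spr t)"
    proof (intro sum_mono)
      fix j
      have "G2 * norm (x i t - x j t) \<le> G2 * spr t" by (intro mult_left_mono norm_x_diff_le G2_nonneg)
      with viol_Lipschitz[OF t x_mem[OF t] x_mem[OF t], of j i j]
      show "viol j t (x i t) \<le> viol j t (x j t) + G2 * spr t" by linarith
    qed
    finally show ?thesis by (simp add: Q_def sum.distrib agents_def)
  qed
  then have "net_ccv m g x T \<le> (1 / agents) * (\<Sum>i\<in>(UNIV :: 'n set). \<Sum>t=1..T. Q t + agents * G2 * spr t)"
    unfolding net_ccv_def agents_def[symmetric] using agents_pos by (intro mult_left_mono sum_mono) auto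
  also have "\<dots> = (\<Sum>t=1..T. Q t) + agents * G2 * (\<Sum>t=1..T. spr t)"
    using agents_pos by (simp add: sum.distrib agents_def flip: sum_distrib_left)
  also have "(\<Sum>t=1..T. Q t) \<le> (\<Sum>t=1..T. \<alpha> t + \<delta> t + Q t)"
    using \<alpha>(1) \<delta>_nonneg by (intro sum_mono) (auto simp: less_imp_le)
  also have "agents * G2 * (\<Sum>t=1..T. spr t)
    \<le> agents * G2 * (consensus_const * (1 + (\<Sum>t=1..T. \<alpha> t + \<delta> t + Q t)))"
    using agents_pos G2_nonneg by (intro mult_left_mono sum_spr_le) auto
  finally show ?thesis by (simp add: algebra_simps)
qed

text \<open>Regret is the sum of a telescoping part and a price for disagreement. The latter brings
  in \<open>Q t\<close> linearly, and the squared violations divided by \<open>\<alpha> t\<close>,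
  left over from the descent inequality, absorb it up to a multiple of
  \<open>\<alpha> t\<close>.\<close>

lemma net_reg_le:
  assumes T: "T \<ge> 1"
  defines "b \<equiv> regret_const"
  shows "net_reg X m df g x T \<le> 2 * R\<^sup>2 / \<alpha> T + b
    + (\<Sum>t=1..T. (G1\<^sup>2 + b + b\<^sup>2 * agents\<^sup>2 / (3 * \<gamma>0)) * \<alpha> t + b * \<delta> t + 2 * R / agents * (\<delta> t / \<alpha> t))"
    (is "_ \<le> ?U")
proof -
  define c where "c = 2 * R * \<bar>L\<bar> + G1"
  have c: "0 \<le> c" using R_nonneg G1_nonneg by (simp add: c_def)
  have b: "0 \<le> b" "c * consensus_const = b" using c consensus_const_nonneg by (auto simp: b_def regret_const_def c_def)
  have main: "(\<Sum>t=1..T. avg_grad df t (x i t) \<bullet> (x i t - y)) \<le> ?U" if y: "y \<in> feasible X m g T" for i y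
  proof -
    have yX: "y \<in> X" and gy: "\<And>t j k. t \<in> {1..T} \<Longrightarrow> k < m j \<Longrightarrow> g j t y k \<le> - 0"
      using y by (auto simp: feasible_def)
    define h where "h t = (\<Sum>j\<in>UNIV. df j t (x j t) \<bullet> (x j t - y))" for t
    \<comment> \<open>The algorithm moves agent \<open>j\<close> along its gradient at its own
      point, while regret uses every gradient at the point of agent \<open>i\<close>. Both the
      gradient and the point are exchanged here.\<close>
    have 1: "avg_grad df t (x i t) \<bullet> (x i t - y) \<le> h t / agents + c * spr t" if "t \<in> {1..T}" for t
    proof -
      have t: "t \<ge> 1" using that by simp
      note [simp] = x_mem[OF t] yX
      have "df j t (x i t) \<bullet> (x i t - y) \<le> df j t (x j t) \<bullet> (x j t - y) + c * spr t" for j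
      proof -
        have "(df j t (x i t) - df j t (x j t)) \<bullet> (x i t - y) \<le> norm (df j t (x i t) - df j t (x j t)) * norm (x i t - y)"
          by (rule norm_cauchy_schwarz)
        also have "\<dots> \<le> (\<bar>L\<bar> * spr t) * (2 * R)"
        proof (intro mult_mono norm_diff_le)
          have "norm (df j t (x i t) - df j t (x j t)) \<le> L * norm (x i t - x j t)" by (rule df_Lipschitz[OF t]) auto
          also have "\<dots> \<le> \<bar>L\<bar> * spr t" by (intro mult_mono norm_x_diff_le) auto
          finally show "norm (df j t (x i t) - df j t (x j t)) \<le> \<bar>L\<bar> * spr t" .
        qed (auto simp: spr_nonneg)
        finally have "(df j t (x i t) - df j t (x j t)) \<bullet> (x i t - y) \<le> (\<bar>L\<bar> * spr t) * (2 * R)" .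
        moreover have "df j t (x j t) \<bullet> (x i t - x j t) \<le> G1 * spr t"
          by (intro order_trans[OF norm_cauchy_schwarz] mult_mono df[OF t] norm_x_diff_le G1_nonneg) auto
        ultimately show ?thesis by (simp add: c_def inner_diff algebra_simps)
      qed
      then have "(\<Sum>j\<in>UNIV. df j t (x i t) \<bullet> (x i t - y)) \<le> (\<Sum>j\<in>UNIV. df j t (x j t) \<bullet> (x j t - y) + c * spr t)"
        by (intro sum_mono)
      also have "\<dots> = h t + agents * (c * spr t)" by (simp add: h_def sum.distrib agents_def)
      finally have "(1 / agents) * (\<Sum>j\<in>UNIV. df j t (x i t) \<bullet> (x i t - y)) \<le> (1 / agents) * (h t + agents * (c * spr t))"
        using agents_pos by (intro mult_left_mono) auto
      then show ?thesis using agents_pos by (simp add: avg_grad_def inner_sum_left agents_def[symmetric] field_simps)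
    qed
    have 2: "h t / agents \<le> 1 / (2 * agents * \<alpha> t) * (V y t - V y (Suc t))
        + (2 * R / agents * (\<delta> t / \<alpha> t) + G1\<^sup>2 * \<alpha> t - 3 / 4 * \<gamma>0 * QQ t / (agents * \<alpha> t))" if "t \<in> {1..T}" for t
    proof -
      have t: "t \<ge> 1" using that by simp
      have "2 * \<alpha> t * h t \<le> V y t - V y (Suc t) + 4 * R * \<delta> t + 2 * agents * (\<alpha> t)\<^sup>2 * G1\<^sup>2 - 3 / 2 * \<gamma>0 * QQ t"
        using descent[OF t yX order_refl gy[OF that]] by (simp add: h_def)
      then have "1 / (2 * agents * \<alpha> t) * (2 * \<alpha> t * h t)
        \<le> 1 / (2 * agents * \<alpha> t) * (V y t - V y (Suc t) + 4 * R * \<delta> t + 2 * agents * (\<alpha> t)\<^sup>2 * G1\<^sup>2 - 3 / 2 * \<gamma>0 * QQ t)"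
        using \<alpha>(1)[OF t] agents_pos by (intro mult_left_mono) auto
      moreover have "1 / (2 * agents * \<alpha> t) * (2 * \<alpha> t * h t) = h t / agents"
        using \<alpha>(1)[OF t] agents_pos by simp
      moreover have "1 / (2 * agents * \<alpha> t) * (V y t - V y (Suc t) + 4 * R * \<delta> t + 2 * agents * (\<alpha> t)\<^sup>2 * G1\<^sup>2 - 3 / 2 * \<gamma>0 * QQ t)
        = 1 / (2 * agents * \<alpha> t) * (V y t - V y (Suc t))
          + (2 * R / agents * (\<delta> t / \<alpha> t) + G1\<^sup>2 * \<alpha> t - 3 / 4 * \<gamma>0 * QQ t / (agents * \<alpha> t))"
        using \<alpha>(1)[OF t] agents_pos by (simp add: field_simps power2_eq_square)
      ultimately show ?thesis by simp
    qed
    have 3: "b * Q t - 3 / 4 * \<gamma>0 * QQ t / (agents * \<alpha> t) \<le> b\<^sup>2 * agents\<^sup>2 / (3 * \<gamma>0) * \<alpha> t" if "t \<in> {1..T}" for t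
    proof -
      have t: "0 < \<alpha> t" using that \<alpha>(1)[of t] by simp
      \<comment> \<open>Completing the square gives \<open>b\<^sup>2 / (4 * a)\<close> for each
        agent. The sum over the agents explains the square of \<open>agents\<close> in the
        bound.\<close>
      define a where "a = 3 / 4 * \<gamma>0 / (agents * \<alpha> t)"
      have a: "0 < a" using t agents_pos \<gamma>0 by (simp add: a_def)
      have "b * q - a * q\<^sup>2 \<le> b\<^sup>2 / (4 * a)" for q
      proof -
        have "0 \<le> (2 * a * q - b)\<^sup>2" by simp
        then show ?thesis using a by (simp add: field_simps power2_eq_square)
      qed
      then have "(\<Sum>j\<in>UNIV. b * viol j t (x j t) - a * (viol j t (x j t))\<^sup>2) \<le> (\<Sum>j\<in>(UNIV :: 'n set). b\<^sup>2 / (4 * a))"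
        by (intro sum_mono)
      then have "b * Q t - a * QQ t \<le> agents * (b\<^sup>2 / (4 * a))"
        by (simp add: Q_def QQ_def sum_subtractf agents_def flip: sum_distrib_left)
      then show ?thesis using t agents_pos \<gamma>0 by (simp add: a_def field_simps power2_eq_square)
    qed
    have 4: "(\<Sum>t=1..T. 1 / (2 * agents * \<alpha> t) * (V y t - V y (Suc t))) \<le> 1 / (2 * agents * \<alpha> T) * (4 * agents * R\<^sup>2)"
    proof (rule abel_bound[where V="V y"])
      show "1 / (2 * agents * \<alpha> t) \<le> 1 / (2 * agents * \<alpha> (Suc t))" if "t \<ge> 1" for t
        using \<alpha>(2)[OF that] \<alpha>(1)[of t] \<alpha>(1)[of "Suc t"] that agents_pos by (intro divide_left_mono mult_left_mono) auto
      show "0 \<le> 1 / (2 * agents * \<alpha> t)" if "t \<ge> 1" for t using \<alpha>(1)[OF that] agents_pos by simp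
    qed (use T yX in \<open>auto simp: V_nonneg V_le\<close>)
    have 5: "c * (\<Sum>t=1..T. spr t) \<le> b + (\<Sum>t=1..T. b * \<alpha> t + b * \<delta> t + b * Q t)"
    proof -
      have "c * (\<Sum>t=1..T. spr t) \<le> c * (consensus_const * (1 + (\<Sum>t=1..T. \<alpha> t + \<delta> t + Q t)))"
        by (intro mult_left_mono sum_spr_le c)
      also have "\<dots> = b * (1 + (\<Sum>t=1..T. \<alpha> t + \<delta> t + Q t))" by (simp add: b flip: mult.assoc)
      finally show ?thesis by (simp add: algebra_simps sum.distrib sum_distrib_left)
    qed
    have "(\<Sum>t=1..T. avg_grad df t (x i t) \<bullet> (x i t - y)) \<le> (\<Sum>t=1..T. h t / agents + c * spr t)"
      by (intro sum_mono 1)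
    also have "\<dots> = (\<Sum>t=1..T. h t / agents) + c * (\<Sum>t=1..T. spr t)" by (simp add: sum.distrib sum_distrib_left)
    also have "\<dots> \<le> (\<Sum>t=1..T. 1 / (2 * agents * \<alpha> t) * (V y t - V y (Suc t))
        + (2 * R / agents * (\<delta> t / \<alpha> t) + G1\<^sup>2 * \<alpha> t - 3 / 4 * \<gamma>0 * QQ t / (agents * \<alpha> t)))
        + (b + (\<Sum>t=1..T. b * \<alpha> t + b * \<delta> t + b * Q t))"
      by (intro add_mono sum_mono 2 5)
    also have "\<dots> = (\<Sum>t=1..T. 1 / (2 * agents * \<alpha> t) * (V y t - V y (Suc t))) + b
       + (\<Sum>t=1..T. 2 * R / agents * (\<delta> t / \<alpha> t) + G1\<^sup>2 * \<alpha> t + b * \<alpha> t + b * \<delta> t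
          + (b * Q t - 3 / 4 * \<gamma>0 * QQ t / (agents * \<alpha> t)))"
      by (simp add: sum.distrib sum_subtractf)
    also have "\<dots> \<le> 1 / (2 * agents * \<alpha> T) * (4 * agents * R\<^sup>2) + b
       + (\<Sum>t=1..T. 2 * R / agents * (\<delta> t / \<alpha> t) + G1\<^sup>2 * \<alpha> t + b * \<alpha> t + b * \<delta> t
          + b\<^sup>2 * agents\<^sup>2 / (3 * \<gamma>0) * \<alpha> t)"
      by (intro add_mono 4 order_refl sum_mono 3)
    also have "1 / (2 * agents * \<alpha> T) * (4 * agents * R\<^sup>2) = 2 * R\<^sup>2 / \<alpha> T"
      using agents_pos by (simp add: field_simps)
    finally show ?thesis by (simp add: algebra_simps sum.distrib)
  qed
  have "(\<Sum>t=1..T. avg_grad df t (x i t) \<bullet> x i t) - (INF y\<in>feasible X m g T. (\<Sum>t=1..T. avg_grad df t (x i t)) \<bullet> y) \<le> ?U" for i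
  proof -
    \<comment> \<open>As \<open>?U\<close> does not depend on \<open>y\<close>, the bound passes to
      the infimum; a real infimum needs a nonempty feasible set here.\<close>
    have "(\<Sum>t=1..T. avg_grad df t (x i t) \<bullet> x i t) - ?U \<le> (INF y\<in>feasible X m g T. (\<Sum>t=1..T. avg_grad df t (x i t)) \<bullet> y)"
    proof (rule cINF_greatest[OF feasible[OF T]])
      fix y assume "y \<in> feasible X m g T"
      from main[OF this, of i]
      have "(\<Sum>t=1..T. avg_grad df t (x i t) \<bullet> x i t) - (\<Sum>t=1..T. avg_grad df t (x i t)) \<bullet> y \<le> ?U"
        by (simp only: inner_diff_right sum_subtractf inner_sum_left)
      then show "(\<Sum>t=1..T. avg_grad df t (x i t) \<bullet> x i t) - ?U \<le> (\<Sum>t=1..T. avg_grad df t (x i t)) \<bullet> y" by linarith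
    qed
    then show ?thesis by linarith
  qed
  then have "net_reg X m df g x T \<le> (1 / agents) * (\<Sum>i\<in>(UNIV :: 'n set). ?U)"
    unfolding net_reg_def agents_def[symmetric] using agents_pos by (intro mult_left_mono sum_mono) auto
  also have "\<dots> = ?U" using agents_pos unfolding sum_agents by simp
  finally show ?thesis .
qed

end

section \<open>Expectations\<close>

text \<open>Each component is at most any of these norms, so summing the components treats all
  \<open>d\<close>, infinity included, with one crude dimension factor.\<close>

lemma norm_le_lp_norm:
  fixes u :: "real^'p"
  assumes "d \<ge> 1"
  shows "norm u \<le> real CARD('p) * lp_norm d u"
proof -
  have "\<bar>u $ i\<bar> \<le> lp_norm d u" for i
  proof (cases "d = \<infinity>")
    case True
    then show ?thesis using component_le_infnorm_cart[of u i] by (simp add: lp_norm_def)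
  next
    case False
    define r where "r = real_of_ereal d"
    have r: "1 \<le> r" using assms False unfolding r_def by (cases d) auto
    have "\<bar>u $ i\<bar> = (\<bar>u $ i\<bar> powr r) powr (1 / r)" using r by (simp add: powr_powr)
    also have "\<dots> \<le> (\<Sum>i\<in>UNIV. \<bar>u $ i\<bar> powr r) powr (1 / r)"
      using r by (intro powr_mono2 member_le_sum) auto
    finally show ?thesis using False by (simp add: lp_norm_def r_def)
  qed
  then have "(\<Sum>i\<in>UNIV. \<bar>u $ i\<bar>) \<le> (\<Sum>i\<in>(UNIV :: 'p set). lp_norm d u)" by (intro sum_mono)
  with norm_le_l1_cart[of u] show ?thesis by simp
qed

text \<open>Conditioning on the past: independence makes the joint law of \<open>u\<close> and
  \<open>r\<close> a product, as checked on rectangles. Tonelli's theorem then integrates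
  \<open>r\<close> first, for a frozen input \<open>y\<close>.\<close>

lemma (in prob_space) nn_integral_indep_le:
  assumes K: "prob_space K" and F: "sets F = sigma_sets (space M) S" "space F = space M"
    and u: "u \<in> borel_measurable F" and r: "r \<in> measurable M K" "distr M K r = K"
    and ind: "indep_set {r -` A \<inter> space M | A. A \<in> sets K} (sigma_sets (space M) S)"
    and \<phi>: "(\<lambda>(y, r). \<phi> y r) \<in> borel_measurable (borel \<Otimes>\<^sub>M K)" and c: "\<And>y. (\<integral>\<^sup>+ r. \<phi> y r \<partial>K) \<le> c"
  shows "(\<integral>\<^sup>+ a. \<phi> (u a) (r a) \<partial>M) \<le> c"
proof -
  interpret K: prob_space K by fact
  have ev: "sigma_sets (space M) S \<subseteq> events" using ind by (simp add: indep_sets2_eq)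
  have uM: "u \<in> borel_measurable M"
    by (rule measurable_from_subalg[OF _ u]) (simp add: subalgebra_def F ev)
  interpret U: prob_space "distr M borel u" by (rule prob_space_distr[OF uM])
  have prod: "distr M borel u \<Otimes>\<^sub>M K = distr M (borel \<Otimes>\<^sub>M K) (\<lambda>a. (u a, r a))"
  proof (rule pair_measure_eqI)
    fix A B assume A: "A \<in> sets (distr M borel u)" and B: "B \<in> sets K"
    have uA: "u -` A \<inter> space M \<in> sigma_sets (space M) S" using measurable_sets[OF u, of A] A by (simp add: F)
    then have "prob ((r -` B \<inter> space M) \<inter> (u -` A \<inter> space M)) = prob (r -` B \<inter> space M) * prob (u -` A \<inter> space M)"
      using ind B unfolding indep_sets2_eq by blast
    moreover have "emeasure K B = prob (r -` B \<inter> space M)"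
      using emeasure_distr[OF r(1) B] by (simp add: r(2) emeasure_eq_measure)
    moreover have "(\<lambda>a. (u a, r a)) -` (A \<times> B) \<inter> space M = (r -` B \<inter> space M) \<inter> (u -` A \<inter> space M)" by auto
    ultimately show "emeasure (distr M borel u) A * emeasure K B
        = emeasure (distr M (borel \<Otimes>\<^sub>M K) (\<lambda>a. (u a, r a))) (A \<times> B)"
      using A B uM r(1) by (simp add: emeasure_distr emeasure_eq_measure ennreal_mult' mult.commute)
  qed (auto simp: U.sigma_finite_measure_axioms K.sigma_finite_measure_axioms cong: sets_pair_measure_cong)
  have "(\<integral>\<^sup>+ a. \<phi> (u a) (r a) \<partial>M) = (\<integral>\<^sup>+ p. (case p of (y, r) \<Rightarrow> \<phi> y r) \<partial>distr M (borel \<Otimes>\<^sub>M K) (\<lambda>a. (u a, r a)))"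
    using uM r \<phi> by (subst nn_integral_distr) auto
  also have "\<dots> = (\<integral>\<^sup>+ y. \<integral>\<^sup>+ r. \<phi> y r \<partial>K \<partial>distr M borel u)"
    unfolding prod[symmetric] using \<phi> by (subst K.nn_integral_fst[symmetric]) (auto cong: measurable_cong_sets)
  also have "\<dots> \<le> (\<integral>\<^sup>+ y. c \<partial>distr M borel u)" by (intro nn_integral_mono c)
  also have "\<dots> = c" using U.emeasure_space_1 by simp
  finally show ?thesis .
qed

text \<open>The infimum in the regret runs over an uncountable set, so its measurability comes from
  its continuity in the accumulated gradient.\<close>

lemma support_function_Lipschitz:
  fixes F :: "'a::real_inner set"
  assumes F: "F \<noteq> {}" "\<And>y. y \<in> F \<Longrightarrow> norm y \<le> R"
  shows "\<bar>(INF y\<in>F. u \<bullet> y) - (INF y\<in>F. u' \<bullet> y)\<bar> \<le> R * norm (u - u')"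
proof -
  have bdd: "bdd_below ((\<lambda>y. u \<bullet> y) ` F)" for u
  proof (rule bdd_belowI2)
    fix y assume "y \<in> F"
    then have "\<bar>u \<bullet> y\<bar> \<le> norm u * R" using F by (intro order_trans[OF Cauchy_Schwarz_ineq2] mult_left_mono) auto
    then show "- (norm u * R) \<le> u \<bullet> y" by linarith
  qed
  have le: "(INF y\<in>F. u \<bullet> y) - R * norm (u - u') \<le> (INF y\<in>F. u' \<bullet> y)" for u u'
  proof (rule cINF_greatest[OF F(1)])
    fix y assume y: "y \<in> F"
    have "(INF y\<in>F. u \<bullet> y) \<le> u \<bullet> y" using y by (intro cINF_lower bdd)
    moreover have "(u - u') \<bullet> y \<le> norm (u - u') * norm y" by (rule norm_cauchy_schwarz)
    moreover have "norm (u - u') * norm y \<le> norm (u - u') * R" using F(2)[OF y] by (intro mult_left_mono) auto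
    ultimately show "(INF y\<in>F. u \<bullet> y) - R * norm (u - u') \<le> u' \<bullet> y" by (simp add: inner_diff_left algebra_simps)
  qed
  show ?thesis using le[of u u'] le[of u' u] by (simp add: norm_minus_commute abs_le_iff)
qed

section \<open>Continuity of the problem data on the decision set\<close>

context online_problem
begin

text \<open>A single row is the combination with a unit coefficient vector.\<close>

lemma norm_dg_le: "t \<ge> 1 \<Longrightarrow> u \<in> X \<Longrightarrow> k < m i \<Longrightarrow> norm (dg i t u k) \<le> G2"
proof -
  assume t: "t \<ge> 1" "u \<in> X" and k: "k < m i"
  have "(\<Sum>l<m i. (if l = k then 1 else 0) *\<^sub>R dg i t u l) = dg i t u k"
    using k by (simp add: if_distrib[where f="\<lambda>u. u *\<^sub>R _"] cong: if_cong)
  moreover have "L2_set (\<lambda>l. if l = k then 1 else 0) {..<m i} = 1"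
    using k by (simp add: L2_set_def if_distrib[where f="\<lambda>u. u ^ 2"] cong: if_cong)
  ultimately show ?thesis using dg_combination[OF t, of "\<lambda>l. if l = k then 1 else 0" i] by simp
qed

lemma g_Lipschitz:
  assumes t: "t \<ge> 1" and u: "u \<in> X" and y: "y \<in> X" and k: "k < m i"
  shows "g i t u k - g i t y k \<le> G2 * norm (u - y)"
proof -
  have "g i t u k - g i t y k \<le> dg i t u k \<bullet> (u - y)" using dg[OF t u k y] by (simp add: inner_diff_right)
  also have "\<dots> \<le> norm (dg i t u k) * norm (u - y)" by (rule norm_cauchy_schwarz)
  also have "\<dots> \<le> G2 * norm (u - y)" by (intro mult_right_mono norm_dg_le[OF t u k]) auto
  finally show ?thesis .
qed

lemma continuous_on_g: "t \<ge> 1 \<Longrightarrow> k < m i \<Longrightarrow> continuous_on X (\<lambda>u. g i t u k)"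
  by (intro lipschitz_on_continuous_on[of G2] lipschitz_onI)
    (auto simp: dist_norm abs_le_iff G2_nonneg intro: g_Lipschitz g_Lipschitz[THEN order_trans] simp: norm_minus_commute)

lemma continuous_on_df: "t \<ge> 1 \<Longrightarrow> continuous_on X (df i t)"
proof (intro lipschitz_on_continuous_on[of "\<bar>L\<bar>"] lipschitz_onI)
  fix u y assume "t \<ge> 1" "u \<in> X" "y \<in> X"
  then have "norm (df i t u - df i t y) \<le> L * norm (u - y)" by (rule df_Lipschitz)
  also have "\<dots> \<le> \<bar>L\<bar> * norm (u - y)" by (intro mult_right_mono) auto
  finally show "dist (df i t u) (df i t y) \<le> \<bar>L\<bar> * dist u y" by (simp add: dist_norm)
qed simp

lemma measurable_proj: "closest_point X \<in> borel_measurable borel"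
  by (intro borel_measurable_continuous_onI continuous_on_closest_point X X_nonempty)

end

section \<open>The random trajectory and its measurability with respect to earlier calls\<close>

text \<open>The iterates are arbitrary functions of the outcome that obey the recursion; their
  measurability is derived, not assumed.\<close>

locale random_run = online_problem X E W m df g dg cmp z1 R G1 G2 L w \<gamma>0 B \<alpha> \<gamma> s + prob_space M
  for X :: "(real^'p) set"
    and E :: "nat \<Rightarrow> ('n::finite \<times> 'n) set"
    and W m df g dg and cmp :: "real^'p \<Rightarrow> 'r \<Rightarrow> real^'p" and z1 R G1 G2 L w \<gamma>0 B \<alpha> \<gamma> s
    and M :: "'w measure" +
  fixes K :: "'r measure" and \<xi> :: "'n \<Rightarrow> nat \<Rightarrow> 'w \<Rightarrow> 'r" and z zhat x \<omega> :: "'n \<Rightarrow> nat \<Rightarrow> 'w \<Rightarrow> real^'p"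
    and v :: "'n \<Rightarrow> nat \<Rightarrow> 'w \<Rightarrow> nat \<Rightarrow> real" and C :: real and d :: ereal
  assumes K: "prob_space K"
    and dg_measurable: "\<And>i t k. t \<ge> 1 \<Longrightarrow> k < m i \<Longrightarrow> (\<lambda>x. dg i t x k) \<in> borel_measurable (restrict_space borel X)"
    and cmp_measurable: "(\<lambda>(u, r). cmp u r) \<in> borel_measurable (borel \<Otimes>\<^sub>M K)"
    and d: "d \<ge> 1" and C: "C \<ge> 0"
    and cmp_error: "\<And>u. (\<integral>\<^sup>+ r. ennreal ((lp_norm d (cmp u r - u))\<^sup>2) \<partial>K) \<le> ennreal C"
    and fresh: "fresh_randomness M K \<xi>"
    and runs: "\<And>a. a \<in> space M \<Longrightarrow> algorithm_run X W m df g dg cmp \<alpha> \<gamma> s z1 (\<lambda>j t. \<xi> j t a)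
        (\<lambda>i t. z i t a) (\<lambda>i t. zhat i t a) (\<lambda>i t. x i t a) (\<lambda>i t. v i t a) (\<lambda>i t. \<omega> i t a)"
begin

lemma online_run: "a \<in> space M \<Longrightarrow> online_run X E W m df g dg cmp z1 R G1 G2 L w \<gamma>0 B \<alpha> \<gamma> s (\<lambda>j t. \<xi> j t a)
        (\<lambda>i t. z i t a) (\<lambda>i t. zhat i t a) (\<lambda>i t. x i t a) (\<lambda>i t. v i t a) (\<lambda>i t. \<omega> i t a)"
  by (intro online_run.intro online_problem_axioms online_run_axioms.intro runs)

text \<open>Kept in the shape of the generator in \<open>fresh_randomness\<close>, so that
  independence of \<open>past t\<close> can be read off directly.\<close>

definition calls_before :: "nat \<Rightarrow> 'w set set" where
  "calls_before t = {\<xi> k u -` A \<inter> space M | k u A. 1 \<le> u \<and> u < t \<and> A \<in> sets K}"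

definition past :: "nat \<Rightarrow> 'w measure" where
  "past t = sigma (space M) (calls_before t)"

lemma calls_before_Pow: "calls_before t \<subseteq> Pow (space M)" by (auto simp: calls_before_def)

lemma space_past [simp]: "space (past t) = space M"
  unfolding past_def by (rule space_measure_of[OF calls_before_Pow])

lemma sets_past: "sets (past t) = sigma_sets (space M) (calls_before t)"
  unfolding past_def by (rule sets_measure_of[OF calls_before_Pow])

lemma \<xi>_measurable: "t \<ge> 1 \<Longrightarrow> \<xi> j t \<in> measurable M K"
  using fresh by (simp add: fresh_randomness_def)

lemma past_subalgebra: "subalgebra M (past t)"
proof -
  have "calls_before t \<subseteq> sets M"
    using \<xi>_measurable measurable_sets unfolding calls_before_def by blast
  then show ?thesis unfolding subalgebra_def sets_past by (simp add: sets.sigma_sets_subset)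
qed

lemma past_mono: "t \<le> u \<Longrightarrow> subalgebra (past u) (past t)"
  unfolding subalgebra_def sets_past calls_before_def by (auto intro!: sigma_sets_mono') (use less_le_trans in blast)

lemma \<xi>_past: "1 \<le> u \<Longrightarrow> u < t \<Longrightarrow> \<xi> j u \<in> measurable (past t) K"
  using \<xi>_measurable[THEN measurable_space, of u]
  by (intro measurableI) (auto simp: sets_past calls_before_def intro!: sigma_sets.Basic)

lemma x_mem: "a \<in> space M \<Longrightarrow> t \<ge> 1 \<Longrightarrow> x i t a \<in> X"
  by (rule online_run.x_mem[OF online_run])

lemma step_measurable:
  assumes t: "t \<ge> 1" and z: "\<And>i. z i t \<in> borel_measurable (past t)"
    and zh: "\<And>i. zhat i (t - 1) \<in> borel_measurable (past t)"
  shows "zhat i t \<in> borel_measurable (past (Suc t))"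
    and "x i t \<in> borel_measurable (past (Suc t))"
    and "z i (Suc t) \<in> borel_measurable (past (Suc t))"
proof -
  note [measurable] = measurable_from_subalg[OF past_mono[of t "Suc t"] z]
    measurable_from_subalg[OF past_mono[of t "Suc t"] zh] \<xi>_past[OF t, of "Suc t"] measurable_proj
  have cm: "(\<lambda>a. cmp ((1 / s t) *\<^sub>R (z i t a - zhat i (t - 1) a)) (\<xi> i t a)) \<in> borel_measurable (past (Suc t))" for i
  proof -
    have "(\<lambda>a. ((1 / s t) *\<^sub>R (z i t a - zhat i (t - 1) a), \<xi> i t a)) \<in> measurable (past (Suc t)) (borel \<Otimes>\<^sub>M K)"
      by measurable
    from measurable_compose[OF this cmp_measurable] show ?thesis by simp
  qed
  have "(\<lambda>a. closest_point X (zhat i (t - 1) a + s t *\<^sub>R cmp ((1 / s t) *\<^sub>R (z i t a - zhat i (t - 1) a)) (\<xi> i t a)))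
      \<in> borel_measurable (past (Suc t))" for i
    using cm by measurable
  moreover have "zhat i t a = closest_point X (zhat i (t - 1) a + s t *\<^sub>R cmp ((1 / s t) *\<^sub>R (z i t a - zhat i (t - 1) a)) (\<xi> i t a))"
    if "a \<in> space M" for a i using online_run.run_zhat[OF online_run[OF that] t] .
  ultimately show zhat: "zhat i t \<in> borel_measurable (past (Suc t))" for i
    by (subst measurable_cong[where M="past (Suc t)"]) simp_all
  have "(\<lambda>a. \<Sum>j\<in>UNIV. (W t $ i $ j) *\<^sub>R zhat j t a) \<in> borel_measurable (past (Suc t))" for i
    using zhat by measurable
  moreover have "x i t a = (\<Sum>j\<in>UNIV. (W t $ i $ j) *\<^sub>R zhat j t a)" if "a \<in> space M" for a i
    using online_run.run_x[OF online_run[OF that] t] .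
  ultimately show x: "x i t \<in> borel_measurable (past (Suc t))" for i
    by (subst measurable_cong[where M="past (Suc t)"]) simp_all
  \<comment> \<open>The oracles are known to be measurable only on \<open>X\<close>, so
    \<open>x i t\<close> is regarded as a map into that subspace.\<close>
  have [measurable]: "x i t \<in> measurable (past (Suc t)) (restrict_space borel X)"
    by (rule measurable_restrict_space2[OF _ x]) (use x_mem t in auto)
  have [measurable]: "df i t \<in> borel_measurable (restrict_space borel X)"
    by (intro borel_measurable_continuous_on_restrict continuous_on_df t)
  have g [measurable]: "(\<lambda>u. g i t u k) \<in> borel_measurable (restrict_space borel X)" if "k < m i" for k
    by (intro borel_measurable_continuous_on_restrict continuous_on_g t that)
  note [measurable] = dg_measurable[OF t]
  have "(\<lambda>a. \<Sum>k<m i. (\<gamma> t * max 0 (g i t (x i t a) k)) *\<^sub>R dg i t (x i t a) k) \<in> borel_measurable (past (Suc t))"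
    by (intro borel_measurable_sum borel_measurable_scaleR borel_measurable_times borel_measurable_max borel_measurable_const
        measurable_compose[OF _ g] measurable_compose[OF _ dg_measurable[OF t]]) auto
  then have "(\<lambda>a. closest_point X (x i t a - \<alpha> t *\<^sub>R (df i t (x i t a)
      + (\<Sum>k<m i. (\<gamma> t * max 0 (g i t (x i t a) k)) *\<^sub>R dg i t (x i t a) k)))) \<in> borel_measurable (past (Suc t))"
    using x[of i] by measurable
  \<comment> \<open>The dual variable and the direction are eliminated, since \<open>v\<close> is
    determined only on the indices below \<open>m i\<close>.\<close>
  moreover have "z i (Suc t) a = closest_point X (x i t a - \<alpha> t *\<^sub>R (df i t (x i t a)
      + (\<Sum>k<m i. (\<gamma> t * max 0 (g i t (x i t a) k)) *\<^sub>R dg i t (x i t a) k)))" if "a \<in> space M" for a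
    using online_run.run_z[OF online_run[OF that] t, of i] online_run.run_\<omega>[OF online_run[OF that] t, of i]
      online_run.run_v[OF online_run[OF that] t, of _ i] by simp
  ultimately show "z i (Suc t) \<in> borel_measurable (past (Suc t))"
    by (subst measurable_cong[where M="past (Suc t)"]) simp_all
qed

text \<open>The offset is what matters: the two ingredients of the compressor's input at time
  \<open>t\<close> depend only on strictly earlier calls and are thus independent of the call at
  time \<open>t\<close>.\<close>

lemma run_measurable_past:
  assumes "t \<ge> 1"
  shows "z i t \<in> borel_measurable (past t) \<and> zhat i (t - 1) \<in> borel_measurable (past t)"
  using assms
proof (induction t arbitrary: i rule: dec_induct)
  case base
  have "z i 1 \<in> borel_measurable (past 1)"
    by (subst measurable_cong[where g="\<lambda>_. z1 i"]) (use online_run.run_z1[OF online_run] in simp_all)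
  moreover have "zhat i 0 \<in> borel_measurable (past 1)"
    by (subst measurable_cong[where g="\<lambda>_. 0"]) (use online_run.run_zhat0[OF online_run] in simp_all)
  ultimately show ?case by simp
next
  case (step t)
  then show ?case using step_measurable[of t i] by auto
qed

lemma measurable_M: "f \<in> borel_measurable (past t) \<Longrightarrow> f \<in> borel_measurable M"
  by (rule measurable_from_subalg[OF past_subalgebra])

lemma run_measurable:
  assumes "t \<ge> 1"
  shows "z i t \<in> borel_measurable M" "zhat i t \<in> borel_measurable M" "x i t \<in> measurable M (restrict_space borel X)"
  using assms run_measurable_past[OF assms] step_measurable[of t i] run_measurable_past[of "Suc t" i] x_mem
  by (auto intro!: measurable_restrict_space2 intro: measurable_M)

section \<open>Compression error in the mean, and integrability\<close>

definition err :: "nat \<Rightarrow> 'w \<Rightarrow> real" where "err t a = (\<Sum>j\<in>UNIV. norm (zhat j t a - z j t a))"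
definition vio :: "nat \<Rightarrow> 'w \<Rightarrow> real" where "vio t a = (\<Sum>j\<in>UNIV. viol j t (x j t a))"
definition viosq :: "nat \<Rightarrow> 'w \<Rightarrow> real" where "viosq t a = (\<Sum>j\<in>UNIV. (viol j t (x j t a))\<^sup>2)"

definition cmp_const :: real where "cmp_const = agents * (1 + (real CARD('p))\<^sup>2 * C) / 2"

lemma cmp_const_nonneg: "0 \<le> cmp_const" using C agents_pos by (simp add: cmp_const_def)

text \<open>The elementary bound \<open>\<epsilon> \<le> (1 + \<epsilon>\<^sup>2) / 2\<close> turns the second moment of the compressor error into
  a first moment, without any appeal to Jensen's inequality.\<close>

lemma expected_err_le:
  assumes t: "t \<ge> 1"
  shows "expectation (err t) \<le> cmp_const * s t"
proof -
  define P where "P = real CARD('p)"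
  have P: "P > 0" by (simp add: P_def)
  have "expectation (\<lambda>a. norm (zhat j t a - z j t a)) \<le> s t / 2 * (1 + P\<^sup>2 * C)" for j
  proof -
    define u where "u a = (1 / s t) *\<^sub>R (z j t a - zhat j (t - 1) a)" for a
    define \<phi> where "\<phi> y r = ennreal (s t / 2 * (1 + (norm (cmp y r - y))\<^sup>2))" for y r
    note st = s[OF t]
    have "norm (zhat j t a - z j t a) \<le> s t / 2 * (1 + (norm (cmp (u a) (\<xi> j t a) - u a))\<^sup>2)" if a: "a \<in> space M" for a
    proof -
      have "zhat j t a = closest_point X (zhat j (t - 1) a + s t *\<^sub>R cmp (u a) (\<xi> j t a))"
        using online_run.run_zhat[OF online_run[OF a] t] by (simp add: u_def)
      \<comment> \<open>As \<open>z j t a\<close> lies in \<open>X\<close>, projecting cannot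
        increase the distance to it. What remains is exactly \<open>s t\<close> times the compressor
        error at the input \<open>u a\<close>.\<close>
      then have "norm (zhat j t a - z j t a) \<le> norm (zhat j (t - 1) a + s t *\<^sub>R cmp (u a) (\<xi> j t a) - z j t a)"
        using proj_dist[OF online_run.z_mem[OF online_run[OF a] t]] by simp
      also have "zhat j (t - 1) a + s t *\<^sub>R cmp (u a) (\<xi> j t a) - z j t a = s t *\<^sub>R (cmp (u a) (\<xi> j t a) - u a)"
        using st by (simp add: u_def scaleR_diff_right)
      also have "norm \<dots> \<le> s t * ((1 + (norm (cmp (u a) (\<xi> j t a) - u a))\<^sup>2) / 2)"
        using st sum_squares_bound[of 1 "norm (cmp (u a) (\<xi> j t a) - u a)"] by simp
      finally show ?thesis by simp
    qed
    then have "(\<integral>\<^sup>+ a. ennreal (norm (zhat j t a - z j t a)) \<partial>M) \<le> (\<integral>\<^sup>+ a. \<phi> (u a) (\<xi> j t a) \<partial>M)"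
      unfolding \<phi>_def by (intro nn_integral_mono ennreal_leI) auto
    also have "\<dots> \<le> ennreal (s t / 2 * (1 + P\<^sup>2 * C))"
    proof (rule nn_integral_indep_le[OF K sets_past[of t] space_past, where u=u and r="\<xi> j t" and \<phi>=\<phi>])
      show "u \<in> borel_measurable (past t)"
        unfolding u_def using run_measurable_past[OF t, of j]
        by (intro borel_measurable_scaleR borel_measurable_diff borel_measurable_const) auto
      show "\<xi> j t \<in> measurable M K" by (rule \<xi>_measurable[OF t])
      show "distr M K (\<xi> j t) = K" using fresh t by (simp add: fresh_randomness_def)
      show "indep_set {\<xi> j t -` A \<inter> space M |A. A \<in> sets K} (sigma_sets (space M) (calls_before t))"
        using fresh t unfolding fresh_randomness_def calls_before_def by blast
      note [measurable] = cmp_measurable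
      show "(\<lambda>(y, r). \<phi> y r) \<in> borel_measurable (borel \<Otimes>\<^sub>M K)" unfolding \<phi>_def by measurable
      fix y
      have m: "(\<lambda>r. (norm (cmp y r - y))\<^sup>2 / P\<^sup>2) \<in> borel_measurable K"
        using measurable_compose[OF measurable_Pair1' cmp_measurable, of y] by simp
      have "(norm (cmp y r - y))\<^sup>2 / P\<^sup>2 \<le> (lp_norm d (cmp y r - y))\<^sup>2" for r
        using power_mono[OF norm_le_lp_norm[OF d, of "cmp y r - y"], of 2] P
        by (simp add: divide_le_eq power_mult_distrib mult.commute P_def)
      then have *: "(\<integral>\<^sup>+ r. ennreal ((norm (cmp y r - y))\<^sup>2 / P\<^sup>2) \<partial>K) \<le> ennreal C"
        by (intro order_trans[OF nn_integral_mono cmp_error[of y]] ennreal_leI)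
      have "\<phi> y r = ennreal (s t / 2) + ennreal (s t / 2 * P\<^sup>2) * ennreal ((norm (cmp y r - y))\<^sup>2 / P\<^sup>2)" for r
        unfolding \<phi>_def using st P
        by (simp add: algebra_simps flip: ennreal_mult ennreal_plus)
      then have "(\<integral>\<^sup>+ r. \<phi> y r \<partial>K) = ennreal (s t / 2) + ennreal (s t / 2 * P\<^sup>2) * (\<integral>\<^sup>+ r. ennreal ((norm (cmp y r - y))\<^sup>2 / P\<^sup>2) \<partial>K)"
        using m by (simp add: nn_integral_add nn_integral_cmult prob_space.emeasure_space_1[OF K])
      also have "\<dots> \<le> ennreal (s t / 2) + ennreal (s t / 2 * P\<^sup>2) * ennreal C"
        by (intro add_left_mono mult_left_mono *) auto
      also have "\<dots> = ennreal (s t / 2 * (1 + P\<^sup>2 * C))"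
        using st C by (simp add: algebra_simps flip: ennreal_mult ennreal_plus)
      finally show "(\<integral>\<^sup>+ r. \<phi> y r \<partial>K) \<le> ennreal (s t / 2 * (1 + P\<^sup>2 * C))" .
    qed
    finally show ?thesis using st C by (intro integral_real_bounded) auto
  qed
  then have "(\<Sum>j\<in>UNIV. expectation (\<lambda>a. norm (zhat j t a - z j t a))) \<le> (\<Sum>j\<in>(UNIV :: 'n set). s t / 2 * (1 + P\<^sup>2 * C))"
    by (intro sum_mono)
  moreover have "integrable M (\<lambda>a. norm (zhat j t a - z j t a))" for j
    using run_measurable[OF t, of j] online_run.z_mem[OF online_run t] online_run.zhat_mem[OF online_run t]
    by (intro integrable_const_bound[where B="2 * R"]) (auto intro!: norm_diff_le)
  ultimately show ?thesis
    unfolding err_def by (simp add: cmp_const_def P_def agents_def mult_ac)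
qed

lemma expectation_const_plus_sum:
  fixes f :: "'i \<Rightarrow> 'w \<Rightarrow> real"
  assumes "\<And>t. t \<in> I \<Longrightarrow> integrable M (f t)"
  shows "expectation (\<lambda>a. c + (\<Sum>t\<in>I. f t a)) = c + (\<Sum>t\<in>I. expectation (f t))"
proof -
  have "has_bochner_integral M (\<lambda>a. \<Sum>t\<in>I. f t a) (\<Sum>t\<in>I. expectation (f t))"
    by (intro has_bochner_integral_sum has_bochner_integral_integrable assms)
  moreover have "has_bochner_integral M (\<lambda>_. c) c"
    using has_bochner_integral_integrable[OF integrable_const[of c]] by (simp add: prob_space)
  ultimately show ?thesis by (intro has_bochner_integral_integral_eq has_bochner_integral_add)
qed

lemma integrable_err: "t \<ge> 1 \<Longrightarrow> integrable M (err t)"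
  unfolding err_def
  by (intro Bochner_Integration.integrable_sum integrable_const_bound[where B="2 * R"]
      borel_measurable_norm[THEN measurable_compose[rotated]] borel_measurable_diff run_measurable)
    (auto intro!: norm_diff_le online_run.z_mem[OF online_run] online_run.zhat_mem[OF online_run])

lemma measurable_g_x:
  assumes "t \<ge> 1" "k < m j"
  shows "(\<lambda>a. g j t (x i t a) k) \<in> borel_measurable M"
  by (rule measurable_compose[OF run_measurable(3)[OF assms(1)]])
    (intro borel_measurable_continuous_on_restrict continuous_on_g assms)

lemma measurable_viol: "t \<ge> 1 \<Longrightarrow> (\<lambda>a. viol j t (x j t a)) \<in> borel_measurable M"
  unfolding viol_def L2_set_def
  by (intro borel_measurable_sqrt[THEN measurable_compose[rotated]] borel_measurable_sum borel_measurable_power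
      borel_measurable_max borel_measurable_const measurable_g_x) auto

text \<open>The constraint functions have no prescribed bound. Comparison with the fixed point
  \<open>z1 j\<close> bounds the violation over \<open>X\<close> for each \<open>t\<close>, which
  suffices for integrability.\<close>

lemma viol_le: "t \<ge> 1 \<Longrightarrow> u \<in> X \<Longrightarrow> viol j t u \<le> viol j t (z1 j) + G2 * (2 * R)"
  using viol_Lipschitz[OF _ _ z1, of t u j j] mult_left_mono[OF norm_diff_le[OF _ z1] G2_nonneg, of u j] by simp

lemma integrable_vio: "t \<ge> 1 \<Longrightarrow> integrable M (vio t)"
  unfolding vio_def
  by (intro Bochner_Integration.integrable_sum integrable_const_bound[OF AE_I2])
    (auto simp: measurable_viol viol_nonneg intro!: viol_le x_mem)

lemma integrable_viosq:
  assumes t: "t \<ge> 1"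
  shows "integrable M (viosq t)"
proof -
  have "integrable M (\<lambda>a. (viol j t (x j t a))\<^sup>2)" for j
    using t by (intro integrable_const_bound[where B="(viol j t (z1 j) + G2 * (2 * R))\<^sup>2"] AE_I2 borel_measurable_power measurable_viol)
      (auto simp: viol_nonneg intro!: power_mono viol_le x_mem)
  then show ?thesis unfolding viosq_def by (intro Bochner_Integration.integrable_sum)
qed

lemma expected_vio_nonneg: "0 \<le> expectation (vio t)"
  by (intro Bochner_Integration.integral_nonneg) (auto simp: vio_def sum_nonneg viol_nonneg)

lemma expected_viosq_nonneg: "0 \<le> expectation (viosq t)"
  by (intro Bochner_Integration.integral_nonneg) (auto simp: viosq_def sum_nonneg)

section \<open>Expected cumulative violation and expected regret\<close>

abbreviation "reg T a \<equiv> net_reg X m df g (\<lambda>i t. x i t a) T"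
abbreviation "ccv T a \<equiv> net_ccv m g (\<lambda>i t. x i t a) T"

lemma ccv_nonneg: "0 \<le> ccv T a" by (auto simp: net_ccv_def intro!: sum_nonneg mult_nonneg_nonneg divide_nonneg_nonneg)

lemma ccv_le:
  "a \<in> space M \<Longrightarrow> ccv T a \<le> (1 + agents * G2 * consensus_const) * (1 + (\<Sum>t=1..T. \<alpha> t + err t a + vio t a))"
  using online_run.net_ccv_le[OF online_run, of a T]
  by (simp add: online_run.\<delta>_def[OF online_run] online_run.Q_def[OF online_run] err_def vio_def)

lemma integrable_ccv_bound:
  "integrable M (\<lambda>a. (1 + agents * G2 * consensus_const) * (1 + (\<Sum>t=1..T. \<alpha> t + err t a + vio t a)))"
  by (intro integrable_mult_right Bochner_Integration.integrable_add Bochner_Integration.integrable_sum integrable_const)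
    (auto simp: integrable_err integrable_vio)

lemma integrable_ccv: "integrable M (ccv T)"
proof (rule Bochner_Integration.integrable_bound[OF integrable_ccv_bound])
  show "ccv T \<in> borel_measurable M"
    unfolding net_ccv_def L2_set_def
    by (intro borel_measurable_times borel_measurable_const borel_measurable_sum
        borel_measurable_sqrt[THEN measurable_compose[rotated]])
      (auto intro!: borel_measurable_power borel_measurable_max borel_measurable_const measurable_g_x)
  show "AE a in M. norm (ccv T a) \<le> norm ((1 + agents * G2 * consensus_const) * (1 + (\<Sum>t=1..T. \<alpha> t + err t a + vio t a)))"
  proof (rule AE_I2)
    fix a assume "a \<in> space M"
    from ccv_le[OF this, of T] ccv_nonneg[of a T]
    show "norm (ccv T a) \<le> norm ((1 + agents * G2 * consensus_const) * (1 + (\<Sum>t=1..T. \<alpha> t + err t a + vio t a)))"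
      unfolding real_norm_def by linarith
  qed
qed

lemma expected_ccv_le:
  "expectation (ccv T) \<le> (1 + agents * G2 * consensus_const)
    * (1 + (\<Sum>t=1..T. \<alpha> t + cmp_const * s t + expectation (vio t)))"
proof -
  have "expectation (ccv T) \<le> expectation (\<lambda>a. (1 + agents * G2 * consensus_const) * (1 + (\<Sum>t=1..T. \<alpha> t + err t a + vio t a)))"
    by (intro integral_mono integrable_ccv integrable_ccv_bound ccv_le)
  also have "\<dots> = (1 + agents * G2 * consensus_const) * (1 + (\<Sum>t=1..T. \<alpha> t + expectation (err t) + expectation (vio t)))"
  proof -
    have "expectation (\<lambda>a. 1 + (\<Sum>t=1..T. \<alpha> t + err t a + vio t a))
        = 1 + (\<Sum>t=1..T. expectation (\<lambda>a. \<alpha> t + err t a + vio t a))"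
      by (intro expectation_const_plus_sum Bochner_Integration.integrable_add integrable_const integrable_err integrable_vio) auto
    also have "\<dots> = 1 + (\<Sum>t=1..T. \<alpha> t + expectation (err t) + expectation (vio t))"
      by (intro arg_cong2[where f=plus] refl sum.cong) (simp_all add: integrable_err integrable_vio prob_space)
    finally have "expectation (\<lambda>a. 1 + (\<Sum>t=1..T. \<alpha> t + err t a + vio t a))
        = 1 + (\<Sum>t=1..T. \<alpha> t + expectation (err t) + expectation (vio t))" .
    then show ?thesis by simp
  qed
  also have "\<dots> \<le> (1 + agents * G2 * consensus_const) * (1 + (\<Sum>t=1..T. \<alpha> t + cmp_const * s t + expectation (vio t)))"
    using agents_pos G2_nonneg consensus_const_nonneg
    by (intro mult_left_mono add_left_mono sum_mono add_right_mono expected_err_le) auto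
  finally show ?thesis .
qed

lemma expected_violation_le:
  assumes y: "y \<in> X" and \<sigma>: "0 \<le> \<sigma>" "\<And>t j k. t \<in> {1..T} \<Longrightarrow> k < m j \<Longrightarrow> g j t y k \<le> - \<sigma>"
  shows "(\<Sum>t=1..T. \<gamma>0 * expectation (viosq t) + \<gamma>0 * \<sigma> * expectation (vio t))
    \<le> 4 * agents * R\<^sup>2
      + (\<Sum>t=1..T. 4 * R * (cmp_const * s t) + 2 * agents * (\<alpha> t)\<^sup>2 * G1\<^sup>2 + 4 * agents * R * G1 * \<alpha> t)"
proof -
  have "(\<Sum>t=1..T. \<gamma>0 * expectation (viosq t) + \<gamma>0 * \<sigma> * expectation (vio t))
      = expectation (\<lambda>a. \<Sum>t=1..T. \<gamma>0 * viosq t a + \<gamma>0 * \<sigma> * vio t a)"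
    by (simp add: integrable_vio integrable_viosq)
  also have "\<dots> \<le> expectation (\<lambda>a. 4 * agents * R\<^sup>2
      + (\<Sum>t=1..T. 4 * R * err t a + 2 * agents * (\<alpha> t)\<^sup>2 * G1\<^sup>2 + 4 * agents * R * G1 * \<alpha> t))"
  proof (rule integral_mono)
    show "(\<Sum>t=1..T. \<gamma>0 * viosq t a + \<gamma>0 * \<sigma> * vio t a) \<le> 4 * agents * R\<^sup>2
      + (\<Sum>t=1..T. 4 * R * err t a + 2 * agents * (\<alpha> t)\<^sup>2 * G1\<^sup>2 + 4 * agents * R * G1 * \<alpha> t)" if "a \<in> space M" for a
      using online_run.sum_violation_le[OF online_run[OF that] y \<sigma>]
      by (simp add: online_run.\<delta>_def[OF online_run[OF that]] online_run.Q_def[OF online_run[OF that]]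
          online_run.QQ_def[OF online_run[OF that]] err_def vio_def viosq_def)
  qed (auto intro!: Bochner_Integration.integrable_sum Bochner_Integration.integrable_add
      integrable_mult_right integrable_err integrable_vio integrable_viosq)
  also have "\<dots> = 4 * agents * R\<^sup>2
      + (\<Sum>t=1..T. 4 * R * expectation (err t) + 2 * agents * (\<alpha> t)\<^sup>2 * G1\<^sup>2 + 4 * agents * R * G1 * \<alpha> t)"
    by (subst expectation_const_plus_sum) (auto simp: integrable_err prob_space intro!: sum.cong)
  also have "\<dots> \<le> 4 * agents * R\<^sup>2
      + (\<Sum>t=1..T. 4 * R * (cmp_const * s t) + 2 * agents * (\<alpha> t)\<^sup>2 * G1\<^sup>2 + 4 * agents * R * G1 * \<alpha> t)"
    using R_nonneg by (intro add_left_mono sum_mono add_right_mono mult_left_mono expected_err_le) auto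
  finally show ?thesis .
qed

text \<open>The errors are a parameter because the bound is affine in them: it serves for the
  realized errors, for their means and for the bounds on their means.\<close>

definition reg_bound where
  "reg_bound T e = 2 * R\<^sup>2 / \<alpha> T + regret_const
    + (\<Sum>t=1..T. (G1\<^sup>2 + regret_const + regret_const\<^sup>2 * agents\<^sup>2 / (3 * \<gamma>0)) * \<alpha> t + regret_const * e t
        + 2 * R / agents * (e t / \<alpha> t))"

lemma reg_le: "a \<in> space M \<Longrightarrow> T \<ge> 1 \<Longrightarrow> reg T a \<le> reg_bound T (\<lambda>t. err t a)"
  using online_run.net_reg_le[OF online_run, of a T]
  by (simp add: online_run.\<delta>_def[OF online_run] err_def reg_bound_def)

lemma norm_avg_grad_le: "t \<ge> 1 \<Longrightarrow> u \<in> X \<Longrightarrow> norm (avg_grad df t u) \<le> G1"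
proof -
  assume "t \<ge> 1" "u \<in> X"
  then have "norm (\<Sum>j\<in>UNIV. df j t u) \<le> (\<Sum>j\<in>(UNIV :: 'n set). G1)"
    by (intro order_trans[OF norm_sum] sum_mono df)
  then show ?thesis using agents_pos by (simp add: avg_grad_def agents_def divide_le_eq mult.commute)
qed

text \<open>Regret may be negative, so integrability requires a lower bound besides the upper
  one.\<close>

lemma reg_ge:
  assumes a: "a \<in> space M" and T: "T \<ge> 1"
  shows "- (real T * (G1 * (2 * R))) \<le> reg T a"
proof -
  obtain y where y: "y \<in> feasible X m g T" using feasible[OF T] by auto
  have F: "feasible X m g T \<subseteq> X" by (auto simp: feasible_def)
  have "- (real T * (G1 * (2 * R))) \<le> (\<Sum>t=1..T. avg_grad df t (x i t a) \<bullet> x i t a)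
      - (INF y\<in>feasible X m g T. (\<Sum>t=1..T. avg_grad df t (x i t a)) \<bullet> y)" for i
  proof -
    define S where "S = (\<Sum>t=1..T. avg_grad df t (x i t a))"
    have "bdd_below ((\<lambda>y. S \<bullet> y) ` feasible X m g T)"
    proof (rule bdd_belowI2)
      fix y assume "y \<in> feasible X m g T"
      then have "\<bar>S \<bullet> y\<bar> \<le> norm S * R"
        using F X(3) by (intro order_trans[OF Cauchy_Schwarz_ineq2] mult_left_mono) auto
      then show "- (norm S * R) \<le> S \<bullet> y" by linarith
    qed
    then have "(INF y\<in>feasible X m g T. S \<bullet> y) \<le> S \<bullet> y" using y by (rule cINF_lower)
    moreover have "(\<Sum>t=1..T. - (G1 * (2 * R))) \<le> (\<Sum>t=1..T. avg_grad df t (x i t a) \<bullet> (x i t a - y))"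
    proof (intro sum_mono)
      fix t assume "t \<in> {1..T}"
      then have t: "t \<ge> 1" by simp
      have "\<bar>avg_grad df t (x i t a) \<bullet> (x i t a - y)\<bar> \<le> G1 * (2 * R)"
        using y F by (intro order_trans[OF Cauchy_Schwarz_ineq2] mult_mono norm_avg_grad_le norm_diff_le t x_mem a G1_nonneg) auto
      then show "- (G1 * (2 * R)) \<le> avg_grad df t (x i t a) \<bullet> (x i t a - y)" by linarith
    qed
    ultimately show ?thesis by (simp add: S_def inner_diff_right sum_subtractf inner_sum_left)
  qed
  then have "(1 / agents) * (\<Sum>i\<in>(UNIV :: 'n set). - (real T * (G1 * (2 * R)))) \<le> reg T a"
    unfolding net_reg_def agents_def[symmetric] using agents_pos by (intro mult_left_mono sum_mono) auto
  then show ?thesis using agents_pos unfolding sum_agents by simp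
qed

lemma measurable_reg:
  assumes T: "T \<ge> 1"
  shows "reg T \<in> borel_measurable M"
proof -
  have "continuous_on UNIV (\<lambda>u. INF y\<in>feasible X m g T. u \<bullet> y)"
    by (intro lipschitz_on_continuous_on[of R] lipschitz_onI)
      (use support_function_Lipschitz[OF feasible[OF T], of R] X(3) R_nonneg in \<open>auto simp: dist_norm feasible_def\<close>)
  then have inf: "(\<lambda>u. INF y\<in>feasible X m g T. u \<bullet> y) \<in> borel_measurable borel"
    by (rule borel_measurable_continuous_onI)
  have grad: "(\<lambda>a. avg_grad df t (x i t a)) \<in> borel_measurable M" if "t \<in> {1..T}" for t i
    unfolding avg_grad_def using that
    by (intro borel_measurable_scaleR borel_measurable_const borel_measurable_sum
        measurable_compose[OF run_measurable(3) borel_measurable_continuous_on_restrict] continuous_on_df) auto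
  have x: "x i t \<in> borel_measurable M" if "t \<in> {1..T}" for t i
    using run_measurable(3)[of t i] that by (auto simp: measurable_restrict_space2_iff)
  show ?thesis
    unfolding net_reg_def
    by (intro borel_measurable_times borel_measurable_const borel_measurable_sum borel_measurable_diff
        borel_measurable_inner measurable_compose[OF _ inf] grad x)
qed

lemma integrable_reg_bound: "integrable M (\<lambda>a. reg_bound T (\<lambda>t. err t a))"
  unfolding reg_bound_def
  by (auto intro!: Bochner_Integration.integrable_sum Bochner_Integration.integrable_add
      integrable_mult_right integrable_divide integrable_err)

lemma integrable_reg:
  assumes T: "T \<ge> 1"
  shows "integrable M (reg T)"
proof (rule Bochner_Integration.integrable_bound)
  show "integrable M (\<lambda>a. \<bar>reg_bound T (\<lambda>t. err t a)\<bar> + real T * (G1 * (2 * R)))"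
    by (intro Bochner_Integration.integrable_add integrable_abs integrable_reg_bound integrable_const)
  show "AE a in M. norm (reg T a) \<le> norm (\<bar>reg_bound T (\<lambda>t. err t a)\<bar> + real T * (G1 * (2 * R)))"
  proof (rule AE_I2)
    fix a assume a: "a \<in> space M"
    have "0 \<le> real T * (G1 * (2 * R))" using G1_nonneg R_nonneg by simp
    with reg_le[OF a T] reg_ge[OF a T]
    show "norm (reg T a) \<le> norm (\<bar>reg_bound T (\<lambda>t. err t a)\<bar> + real T * (G1 * (2 * R)))"
      unfolding real_norm_def by linarith
  qed
qed (rule measurable_reg[OF T])

lemma expected_reg_le:
  assumes T: "T \<ge> 1"
  shows "expectation (reg T) \<le> reg_bound T (\<lambda>t. cmp_const * s t)"
proof -
  have b: "0 \<le> regret_const"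
    unfolding regret_const_def using R_nonneg G1_nonneg consensus_const_nonneg by simp
  have "expectation (reg T) \<le> expectation (\<lambda>a. reg_bound T (\<lambda>t. err t a))"
    by (intro integral_mono integrable_reg integrable_reg_bound T reg_le)
  also have "\<dots> = reg_bound T (\<lambda>t. expectation (err t))"
    unfolding reg_bound_def by (subst expectation_const_plus_sum) (auto simp: integrable_err prob_space intro!: sum.cong)
  also have "\<dots> \<le> reg_bound T (\<lambda>t. cmp_const * s t)"
    unfolding reg_bound_def using b agents_pos R_nonneg \<alpha>(1)
    by (intro add_left_mono sum_mono add_mono mult_left_mono divide_right_mono expected_err_le) (auto simp: less_imp_le)
  finally show ?thesis .
qed

end

section \<open>Rates\<close>

lemma sum_power_le:
  assumes "0 < \<mu>" "\<mu> < (1::real)"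
  shows "(\<Sum>t=1..T. \<mu> ^ t) \<le> 1 / (1 - \<mu>)"
proof -
  have "(\<Sum>t=1..T. \<mu> ^ t) \<le> (\<Sum>t<Suc T. \<mu> ^ t)" using assms by (intro sum_mono2) auto
  also have "\<dots> = (1 - \<mu> ^ Suc T) / (1 - \<mu>)" using assms by (subst sum_gp_strict) auto
  also have "\<dots> \<le> 1 / (1 - \<mu>)" using assms by (intro divide_right_mono) auto
  finally show ?thesis .
qed

context random_run
begin

text \<open>Only the order of \<open>\<alpha> t\<close> matters from here on; \<open>c1\<close> and
  \<open>c2\<close> come from the bounds on \<Psi>.\<close>

context
  fixes c1 c2 s0 \<mu> :: real
  assumes c: "0 < c1" "0 < c2" and s0: "0 < s0" and \<mu>: "0 < \<mu>" "\<mu> < 1"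
    and \<alpha>_bounds: "\<And>t. t \<ge> 1 \<Longrightarrow> c1 / sqrt (real t) \<le> \<alpha> t" "\<And>t. t \<ge> 1 \<Longrightarrow> \<alpha> t \<le> c2 / sqrt (real t)"
    and s_eq: "\<And>t. t \<ge> 1 \<Longrightarrow> s t = s0 * \<mu> ^ t"
begin

lemma sum_\<alpha>_le: "(\<Sum>t=1..T. \<alpha> t) \<le> 2 * c2 * sqrt (real T)"
proof -
  have "(\<Sum>t=1..T. \<alpha> t) \<le> (\<Sum>t=1..T. c2 * (1 / sqrt (real t)))" using \<alpha>_bounds(2) by (intro sum_mono) auto
  also have "\<dots> \<le> c2 * (2 * sqrt (real T))"
    unfolding sum_distrib_left[symmetric] using c by (intro mult_left_mono sum_inverse_sqrt_le) auto
  finally show ?thesis by simp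
qed

lemma \<alpha>_sq_le: "t \<ge> 1 \<Longrightarrow> (\<alpha> t)\<^sup>2 \<le> c2 * \<alpha> t"
proof -
  assume t: "t \<ge> 1"
  have "c2 / sqrt (real t) \<le> c2 / 1" using c t by (intro divide_left_mono) auto
  then show ?thesis using \<alpha>_bounds(2)[OF t] \<alpha>(1)[OF t] by (simp add: power2_eq_square mult_right_mono)
qed

lemma inverse_\<alpha>_le: "t \<ge> 1 \<Longrightarrow> t \<le> T \<Longrightarrow> 1 / \<alpha> t \<le> sqrt (real T) / c1"
proof -
  assume t: "t \<ge> 1" "t \<le> T"
  have "1 / \<alpha> t \<le> 1 / (c1 / sqrt (real t))" using \<alpha>_bounds(1)[OF t(1)] c t by (intro divide_left_mono mult_pos_pos \<alpha>) auto
  also have "\<dots> \<le> sqrt (real T) / c1" using c t by (simp add: divide_right_mono)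
  finally show ?thesis .
qed

lemma sum_s_le: "(\<Sum>t=1..T. s t) \<le> s0 / (1 - \<mu>)"
proof -
  have "(\<Sum>t=1..T. s t) = s0 * (\<Sum>t=1..T. \<mu> ^ t)" by (simp add: s_eq sum_distrib_left)
  also have "\<dots> \<le> s0 * (1 / (1 - \<mu>))" using s0 by (intro mult_left_mono sum_power_le \<mu>) auto
  finally show ?thesis by simp
qed

text \<open>The largest inverse step size up to \<open>T\<close> is factored out, and the remaining
  geometric sum is bounded.\<close>

lemma sum_s_div_\<alpha>_le: "(\<Sum>t=1..T. s t / \<alpha> t) \<le> s0 / (1 - \<mu>) * (sqrt (real T) / c1)"
proof -
  have "(\<Sum>t=1..T. s t / \<alpha> t) \<le> (\<Sum>t=1..T. s t * (sqrt (real T) / c1))"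
  proof (intro sum_mono)
    fix t assume t: "t \<in> {1..T}"
    then have "s t * (1 / \<alpha> t) \<le> s t * (sqrt (real T) / c1)"
      using s[of t] by (intro mult_left_mono inverse_\<alpha>_le) auto
    then show "s t / \<alpha> t \<le> s t * (sqrt (real T) / c1)" by simp
  qed
  also have "\<dots> = (\<Sum>t=1..T. s t) * (sqrt (real T) / c1)" by (rule sum_distrib_right[symmetric])
  also have "\<dots> \<le> s0 / (1 - \<mu>) * (sqrt (real T) / c1)" using c by (intro mult_right_mono sum_s_le) auto
  finally show ?thesis .
qed

lemma one_le_sqrt: "T \<ge> 1 \<Longrightarrow> 1 \<le> sqrt (real T)" by simp

lemma le_mult_sqrt: "T \<ge> 1 \<Longrightarrow> 0 \<le> (r :: real) \<Longrightarrow> r \<le> r * sqrt (real T)"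
  using mult_left_mono[OF one_le_sqrt, of T r] by simp

lemma regret_rate: "\<exists>c. \<forall>T\<ge>1. expectation (reg T) \<le> c * sqrt (real T)"
proof (intro exI allI impI)
  fix T :: nat assume T: "T \<ge> 1"
  define b where "b = regret_const"
  define S where "S = s0 / (1 - \<mu>)"
  define A where "A = G1\<^sup>2 + b + b\<^sup>2 * agents\<^sup>2 / (3 * \<gamma>0)"
  define q where "q = sqrt (real T)"
  have b: "0 \<le> b" unfolding b_def regret_const_def using R_nonneg G1_nonneg consensus_const_nonneg by simp
  have A: "0 \<le> A" using b \<gamma>0 by (simp add: A_def)
  have S: "0 \<le> S" using s0 \<mu> by (simp add: S_def)
  have "reg_bound T (\<lambda>t. cmp_const * s t) = 2 * R\<^sup>2 * (1 / \<alpha> T) + b + A * (\<Sum>t=1..T. \<alpha> t)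
      + b * cmp_const * (\<Sum>t=1..T. s t) + 2 * R / agents * cmp_const * (\<Sum>t=1..T. s t / \<alpha> t)"
    by (simp add: reg_bound_def A_def b_def sum.distrib sum_distrib_left mult.assoc)
  also have "\<dots> \<le> 2 * R\<^sup>2 * (q / c1) + b * q + A * (2 * c2 * q)
      + b * cmp_const * S * q + 2 * R / agents * cmp_const * (S * (q / c1))"
  proof (intro add_mono)
    show "2 * R\<^sup>2 * (1 / \<alpha> T) \<le> 2 * R\<^sup>2 * (q / c1)"
      unfolding q_def by (intro mult_left_mono inverse_\<alpha>_le T) auto
    show "b \<le> b * q" unfolding q_def by (rule le_mult_sqrt[OF T b])
    show "A * (\<Sum>t=1..T. \<alpha> t) \<le> A * (2 * c2 * q)" unfolding q_def by (intro mult_left_mono sum_\<alpha>_le A)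
    have "b * cmp_const * (\<Sum>t=1..T. s t) \<le> b * cmp_const * S"
      unfolding S_def using b cmp_const_nonneg by (intro mult_left_mono sum_s_le) auto
    also have "\<dots> \<le> b * cmp_const * S * q"
      unfolding q_def using b cmp_const_nonneg S by (intro le_mult_sqrt[OF T]) auto
    finally show "b * cmp_const * (\<Sum>t=1..T. s t) \<le> b * cmp_const * S * q" .
    show "2 * R / agents * cmp_const * (\<Sum>t=1..T. s t / \<alpha> t) \<le> 2 * R / agents * cmp_const * (S * (q / c1))"
      unfolding q_def S_def using R_nonneg agents_pos cmp_const_nonneg by (intro mult_left_mono sum_s_div_\<alpha>_le) auto
  qed
  also have "\<dots> = (2 * R\<^sup>2 / c1 + b + 2 * A * c2 + b * cmp_const * S + 2 * R / agents * cmp_const * S / c1) * q"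
    by (simp add: algebra_simps)
  finally show "expectation (reg T) \<le> (2 * R\<^sup>2 / c1 + regret_const
      + 2 * (G1\<^sup>2 + regret_const + regret_const\<^sup>2 * agents\<^sup>2 / (3 * \<gamma>0)) * c2
      + regret_const * cmp_const * (s0 / (1 - \<mu>)) + 2 * R / agents * cmp_const * (s0 / (1 - \<mu>)) / c1) * sqrt (real T)"
    using expected_reg_le[OF T] unfolding b_def A_def S_def q_def by linarith
qed

text \<open>The constant is chosen before \<open>T\<close>, \<open>y\<close> and \<sigma>. This
  uniformity is essential because a feasible point may change with the horizon.\<close>

lemma violation_rate:
  obtains A where "0 \<le> A"
    and "\<And>T y \<sigma>. T \<ge> 1 \<Longrightarrow> y \<in> X \<Longrightarrow> 0 \<le> \<sigma> \<Longrightarrow> (\<And>t j k. t \<in> {1..T} \<Longrightarrow> k < m j \<Longrightarrow> g j t y k \<le> - \<sigma>)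
      \<Longrightarrow> (\<Sum>t=1..T. \<gamma>0 * expectation (viosq t) + \<gamma>0 * \<sigma> * expectation (vio t)) \<le> A * sqrt (real T)"
proof
  define S where "S = s0 / (1 - \<mu>)"
  define D where "D = 2 * agents * c2 * G1\<^sup>2 + 4 * agents * R * G1"
  have S: "0 \<le> S" using s0 \<mu> by (simp add: S_def)
  have D: "0 \<le> D" using agents_pos c R_nonneg G1_nonneg by (simp add: D_def)
  define A where "A = 4 * agents * R\<^sup>2 + 4 * R * cmp_const * S + 2 * c2 * D"
  show "0 \<le> A" using agents_pos R_nonneg cmp_const_nonneg S D c by (simp add: A_def)
  fix T y \<sigma>
  assume T: "T \<ge> 1" and y: "y \<in> X" "0 \<le> \<sigma>" "\<And>t j k. t \<in> {1..T} \<Longrightarrow> k < m j \<Longrightarrow> g j t y k \<le> - \<sigma>"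
  note expected_violation_le[OF y, of T]
  also have "(\<Sum>t=1..T. 4 * R * (cmp_const * s t) + 2 * agents * (\<alpha> t)\<^sup>2 * G1\<^sup>2 + 4 * agents * R * G1 * \<alpha> t)
      \<le> (\<Sum>t=1..T. 4 * R * cmp_const * s t + D * \<alpha> t)"
  proof (intro sum_mono)
    fix t assume "t \<in> {1..T}"
    then have "2 * agents * G1\<^sup>2 * (\<alpha> t)\<^sup>2 \<le> 2 * agents * G1\<^sup>2 * (c2 * \<alpha> t)"
      using agents_pos by (intro mult_left_mono \<alpha>_sq_le) auto
    then show "4 * R * (cmp_const * s t) + 2 * agents * (\<alpha> t)\<^sup>2 * G1\<^sup>2 + 4 * agents * R * G1 * \<alpha> t
        \<le> 4 * R * cmp_const * s t + D * \<alpha> t"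
      by (simp add: D_def algebra_simps)
  qed
  also have "\<dots> = 4 * R * cmp_const * (\<Sum>t=1..T. s t) + D * (\<Sum>t=1..T. \<alpha> t)"
    by (simp add: sum.distrib sum_distrib_left)
  also have "\<dots> \<le> 4 * R * cmp_const * S + D * (2 * c2 * sqrt (real T))"
    unfolding S_def using R_nonneg cmp_const_nonneg D by (intro add_mono mult_left_mono sum_s_le sum_\<alpha>_le) auto
  finally have "(\<Sum>t=1..T. \<gamma>0 * expectation (viosq t) + \<gamma>0 * \<sigma> * expectation (vio t))
      \<le> (4 * agents * R\<^sup>2 + 4 * R * cmp_const * S) + 2 * c2 * D * sqrt (real T)" using y by (simp add: mult_ac)
  also have "4 * agents * R\<^sup>2 + 4 * R * cmp_const * S \<le> (4 * agents * R\<^sup>2 + 4 * R * cmp_const * S) * sqrt (real T)"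
    using agents_pos R_nonneg cmp_const_nonneg S by (intro le_mult_sqrt[OF T]) auto
  finally show "(\<Sum>t=1..T. \<gamma>0 * expectation (viosq t) + \<gamma>0 * \<sigma> * expectation (vio t)) \<le> A * sqrt (real T)"
    by (simp add: A_def algebra_simps)
qed

lemma expected_ccv_rate:
  obtains A where "0 \<le> A"
    and "\<And>T. T \<ge> 1 \<Longrightarrow> expectation (ccv T) \<le> A * (sqrt (real T) + (\<Sum>t=1..T. expectation (vio t)))"
proof
  define H where "H = 1 + agents * G2 * consensus_const"
  define S where "S = s0 / (1 - \<mu>)"
  define A where "A = H * (1 + 2 * c2 + cmp_const * S)"
  have S: "0 \<le> S" using s0 \<mu> by (simp add: S_def)
  have H: "0 \<le> H" using agents_pos G2_nonneg consensus_const_nonneg by (simp add: H_def)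
  show "0 \<le> A" using H c cmp_const_nonneg S by (simp add: A_def)
  fix T :: nat assume T: "T \<ge> 1"
  define Y where "Y = (\<Sum>t=1..T. expectation (vio t))"
  define q where "q = sqrt (real T)"
  have Y: "0 \<le> Y" by (auto simp: Y_def intro!: sum_nonneg expected_vio_nonneg)
  have "(\<Sum>t=1..T. \<alpha> t + cmp_const * s t + expectation (vio t)) = (\<Sum>t=1..T. \<alpha> t) + cmp_const * (\<Sum>t=1..T. s t) + Y"
    by (simp add: sum.distrib sum_distrib_left Y_def)
  also have "\<dots> \<le> 2 * c2 * q + cmp_const * S * q + Y"
  proof (intro add_mono order_refl)
    show "(\<Sum>t=1..T. \<alpha> t) \<le> 2 * c2 * q" unfolding q_def by (rule sum_\<alpha>_le)
    have "cmp_const * (\<Sum>t=1..T. s t) \<le> cmp_const * S"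
      unfolding S_def using cmp_const_nonneg by (intro mult_left_mono sum_s_le)
    also have "\<dots> \<le> cmp_const * S * q" unfolding q_def using cmp_const_nonneg S by (intro le_mult_sqrt[OF T]) auto
    finally show "cmp_const * (\<Sum>t=1..T. s t) \<le> cmp_const * S * q" .
  qed
  finally have "1 + (\<Sum>t=1..T. \<alpha> t + cmp_const * s t + expectation (vio t)) \<le> (1 + 2 * c2 + cmp_const * S) * q + Y"
    using one_le_sqrt[OF T] unfolding q_def[symmetric] distrib_right mult_1_left by linarith
  also have "\<dots> \<le> (1 + 2 * c2 + cmp_const * S) * (q + Y)"
    using Y c cmp_const_nonneg S by (simp add: algebra_simps)
  finally have "H * (1 + (\<Sum>t=1..T. \<alpha> t + cmp_const * s t + expectation (vio t))) \<le> H * ((1 + 2 * c2 + cmp_const * S) * (q + Y))"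
    using H by (intro mult_left_mono)
  with expected_ccv_le[of T, folded H_def]
  have "expectation (ccv T) \<le> H * ((1 + 2 * c2 + cmp_const * S) * (q + Y))" by linarith
  then show "expectation (ccv T) \<le> A * (sqrt (real T) + (\<Sum>t=1..T. expectation (vio t)))"
    unfolding A_def Y_def q_def mult.assoc .
qed

text \<open>Cauchy--Schwarz in the form \<open>q \<le> (r q\<^sup>2 + 1 / r) / 2\<close> with \<open>r = T powr (1 / 4)\<close>.\<close>

lemma ccv_rate: "\<exists>c. \<forall>T\<ge>1. expectation (ccv T) \<le> c * real T powr (3 / 4)"
proof -
  obtain A where A: "0 \<le> A" "\<And>T y \<sigma>. T \<ge> 1 \<Longrightarrow> y \<in> X \<Longrightarrow> 0 \<le> \<sigma> \<Longrightarrow> (\<And>t j k. t \<in> {1..T} \<Longrightarrow> k < m j \<Longrightarrow> g j t y k \<le> - \<sigma>)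
      \<Longrightarrow> (\<Sum>t=1..T. \<gamma>0 * expectation (viosq t) + \<gamma>0 * \<sigma> * expectation (vio t)) \<le> A * sqrt (real T)"
    using violation_rate by blast
  obtain H where H: "0 \<le> H" "\<And>T. T \<ge> 1 \<Longrightarrow> expectation (ccv T) \<le> H * (sqrt (real T) + (\<Sum>t=1..T. expectation (vio t)))"
    using expected_ccv_rate by blast
  have "expectation (ccv T) \<le> H * (1 + (A / \<gamma>0 + agents) / 2) * real T powr (3 / 4)" if T: "T \<ge> 1" for T
  proof -
    define r where "r = real T powr (1 / 4)"
    have r: "0 < r" using T by (simp add: r_def)
    have Tr: "real T = r ^ 4" "sqrt (real T) = r\<^sup>2" "real T powr (3 / 4) = r ^ 3"
      using T by (simp_all add: r_def powr_half_sqrt[symmetric] powr_powr flip: powr_realpow)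
    \<comment> \<open>The point is chosen afresh for each \<open>T\<close>; with slack 0 only the
      squared violations are controlled.\<close>
    obtain y where "y \<in> feasible X m g T" using feasible[OF T] by auto
    then have "(\<Sum>t=1..T. \<gamma>0 * expectation (viosq t) + \<gamma>0 * 0 * expectation (vio t)) \<le> A * sqrt (real T)"
      by (intro A(2)[OF T, of y 0]) (auto simp: feasible_def)
    then have sq: "(\<Sum>t=1..T. expectation (viosq t)) \<le> A / \<gamma>0 * r\<^sup>2"
      using \<gamma>0 by (simp add: field_simps Tr(2) flip: sum_distrib_left)
    have "expectation (vio t) \<le> r / 2 * expectation (viosq t) + agents / (2 * r)" if t: "t \<in> {1..T}" for t
    proof -
      have "vio t a \<le> r / 2 * viosq t a + agents / (2 * r)" for a
      proof -
        have "q \<le> r / 2 * q\<^sup>2 + 1 / (2 * r)" for q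
        proof -
          have "0 \<le> (r * q - 1)\<^sup>2" by simp
          then show ?thesis using r by (simp add: field_simps power2_eq_square)
        qed
        then have "vio t a \<le> (\<Sum>j\<in>(UNIV :: 'n set). r / 2 * (viol j t (x j t a))\<^sup>2 + 1 / (2 * r))"
          unfolding vio_def by (intro sum_mono)
        then show ?thesis by (simp add: viosq_def sum.distrib sum_distrib_left agents_def)
      qed
      then have "expectation (vio t) \<le> expectation (\<lambda>a. r / 2 * viosq t a + agents / (2 * r))"
        using t by (intro integral_mono) (auto simp: integrable_vio integrable_viosq)
      then show ?thesis using t by (simp add: integrable_viosq prob_space)
    qed
    then have "(\<Sum>t=1..T. expectation (vio t)) \<le> (\<Sum>t=1..T. r / 2 * expectation (viosq t) + agents / (2 * r))"
      by (intro sum_mono)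
    also have "\<dots> = r / 2 * (\<Sum>t=1..T. expectation (viosq t)) + real T * (agents / (2 * r))"
      by (simp add: sum.distrib sum_distrib_left)
    also have "\<dots> \<le> r / 2 * (A / \<gamma>0 * r\<^sup>2) + real T * (agents / (2 * r))"
      using r by (intro add_right_mono mult_left_mono sq) auto
    \<comment> \<open>The choice of \<open>r\<close> balances the two terms: \<open>r\<close> times
      \<open>r ^ 2\<close>, and \<open>r ^ 4\<close> divided by \<open>r\<close>.\<close>
    also have "\<dots> = (A / \<gamma>0 + agents) / 2 * r ^ 3"
      using r by (simp add: Tr(1) field_simps power2_eq_square power3_eq_cube power4_eq_xxxx)
    finally have vio: "(\<Sum>t=1..T. expectation (vio t)) \<le> (A / \<gamma>0 + agents) / 2 * r ^ 3" .
    have "1 \<le> r" using T by (simp add: r_def ge_one_powr_ge_zero)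
    then have "sqrt (real T) \<le> r ^ 3" unfolding Tr(2) by (intro power_increasing) auto
    with vio have "sqrt (real T) + (\<Sum>t=1..T. expectation (vio t)) \<le> (1 + (A / \<gamma>0 + agents) / 2) * r ^ 3"
      by (simp only: distrib_right mult_1_left add_mono)
    then have "H * (sqrt (real T) + (\<Sum>t=1..T. expectation (vio t))) \<le> H * ((1 + (A / \<gamma>0 + agents) / 2) * r ^ 3)"
      by (rule mult_left_mono[OF _ H(1)])
    with H(2)[OF T] show ?thesis unfolding Tr(3) mult.assoc by linarith
  qed
  then show ?thesis by blast
qed

text \<open>The slack makes the violations themselves appear in the summed descent inequality, so
  the lossy passage from squares to first powers is avoided.\<close>

lemma ccv_rate_Slater:
  assumes y: "y \<in> X" and \<sigma>: "0 < \<sigma>" "\<And>t j k. t \<ge> 1 \<Longrightarrow> k < m j \<Longrightarrow> g j t y k \<le> - \<sigma>"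
  shows "\<exists>c. \<forall>T\<ge>1. expectation (ccv T) \<le> c * sqrt (real T)"
proof -
  obtain A where A: "0 \<le> A" "\<And>T y \<sigma>. T \<ge> 1 \<Longrightarrow> y \<in> X \<Longrightarrow> 0 \<le> \<sigma> \<Longrightarrow> (\<And>t j k. t \<in> {1..T} \<Longrightarrow> k < m j \<Longrightarrow> g j t y k \<le> - \<sigma>)
      \<Longrightarrow> (\<Sum>t=1..T. \<gamma>0 * expectation (viosq t) + \<gamma>0 * \<sigma> * expectation (vio t)) \<le> A * sqrt (real T)"
    using violation_rate by blast
  obtain H where H: "0 \<le> H" "\<And>T. T \<ge> 1 \<Longrightarrow> expectation (ccv T) \<le> H * (sqrt (real T) + (\<Sum>t=1..T. expectation (vio t)))"
    using expected_ccv_rate by blast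
  have "expectation (ccv T) \<le> H * (1 + A / (\<gamma>0 * \<sigma>)) * sqrt (real T)" if T: "T \<ge> 1" for T
  proof -
    have "\<gamma>0 * \<sigma> * (\<Sum>t=1..T. expectation (vio t)) \<le> (\<Sum>t=1..T. \<gamma>0 * expectation (viosq t) + \<gamma>0 * \<sigma> * expectation (vio t))"
      unfolding sum_distrib_left using \<gamma>0 expected_viosq_nonneg by (intro sum_mono) auto
    also have "\<dots> \<le> A * sqrt (real T)" using \<sigma> by (intro A(2)[OF T y]) auto
    finally have "(\<Sum>t=1..T. expectation (vio t)) \<le> A / (\<gamma>0 * \<sigma>) * sqrt (real T)"
      using \<gamma>0 \<sigma> by (simp add: field_simps)
    then have "H * (sqrt (real T) + (\<Sum>t=1..T. expectation (vio t))) \<le> H * ((1 + A / (\<gamma>0 * \<sigma>)) * sqrt (real T))"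
      by (intro mult_left_mono H(1)) (simp add: algebra_simps)
    with H(2)[OF T] show ?thesis unfolding mult.assoc by linarith
  qed
  then show ?thesis by blast
qed

end
end

section \<open>Verification of the parameter conditions and conclusion\<close>

theorem theorem2:
  fixes X :: "(real^'p) set"
    and E :: "nat \<Rightarrow> ('n::finite \<times> 'n) set"
    and W :: "nat \<Rightarrow> real^'n^'n"
    and m :: "'n \<Rightarrow> nat"
    and f :: "'n \<Rightarrow> nat \<Rightarrow> real^'p \<Rightarrow> real"
    and df :: "'n \<Rightarrow> nat \<Rightarrow> real^'p \<Rightarrow> real^'p"
    and g :: "'n \<Rightarrow> nat \<Rightarrow> real^'p \<Rightarrow> nat \<Rightarrow> real"
    and dg :: "'n \<Rightarrow> nat \<Rightarrow> real^'p \<Rightarrow> nat \<Rightarrow> real^'p"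
    and M :: "'w measure" and K :: "'r measure"
    and cmp :: "real^'p \<Rightarrow> 'r \<Rightarrow> real^'p"
    and \<xi> :: "'n \<Rightarrow> nat \<Rightarrow> 'w \<Rightarrow> 'r"
    and z1 :: "'n \<Rightarrow> real^'p"
    and z zhat x \<omega> :: "'n \<Rightarrow> nat \<Rightarrow> 'w \<Rightarrow> real^'p"
    and v :: "'n \<Rightarrow> nat \<Rightarrow> 'w \<Rightarrow> nat \<Rightarrow> real"
    and R G1 G2 L w C \<alpha>0 \<gamma>0 s0 \<mu> :: real and B :: nat and d :: ereal
    and \<Psi> \<alpha> \<gamma> s :: "nat \<Rightarrow> real"
  assumes X: "convex X" "closed X" "\<forall>x\<in>X. norm x \<le> R"
    and feasible: "\<forall>T\<ge>1. feasible X m g T \<noteq> {}"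
    and g_convex: "\<forall>i. \<forall>t\<ge>1. \<forall>k<m i. convex_on X (\<lambda>x. g i t x k)"
    and df: "\<forall>i. \<forall>t\<ge>1. \<forall>x\<in>X. subgradient_on X (f i t) x (df i t x) \<and> norm (df i t x) \<le> G1"
    and dg: "\<forall>i. \<forall>t\<ge>1. \<forall>x\<in>X.
        (\<forall>k<m i. \<forall>y\<in>X. g i t y k \<ge> g i t x k + dg i t x k \<bullet> (y - x)) \<and>
        op_norm (m i) (dg i t x) \<le> G2"
    and dg_measurable:
      "\<forall>i. \<forall>t\<ge>1. \<forall>k<m i. (\<lambda>x. dg i t x k) \<in> borel_measurable (restrict_space borel X)"
    and df_Lipschitz:
      "\<forall>i. \<forall>t\<ge>1. \<forall>x\<in>X. \<forall>y\<in>X. norm (df i t x - df i t y) \<le> L * norm (x - y)"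
    and w: "0 < w" "w < 1"
    and W_weights: "\<forall>t\<ge>1. \<forall>i j.
        (if (j, i) \<in> E t \<or> i = j then W t $ i $ j \<ge> w else W t $ i $ j = 0)"
    and W_stochastic: "\<forall>t\<ge>1. doubly_stochastic (W t)"
    and B: "B > 0" "\<forall>t\<ge>1. strongly_connected (\<Union>l\<in>{0..B - 1}. E (t + l))"
    and M: "prob_space M" and K: "prob_space K"
    and cmp_measurable: "(\<lambda>(u, r). cmp u r) \<in> borel_measurable (borel \<Otimes>\<^sub>M K)"
    and d: "d \<ge> 1" and C: "C \<ge> 0"
    and cmp_error:
      "\<forall>u. (\<integral>\<^sup>+ r. ennreal ((lp_norm d (cmp u r - u))\<^sup>2) \<partial>K) \<le> ennreal C"
    and fresh: "fresh_randomness M K \<xi>"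
    and params: "\<alpha>0 > 0" "0 < \<gamma>0" "\<gamma>0 \<le> 1 / (4 * G2\<^sup>2)" "s0 > 0" "0 < \<mu>" "\<mu> < 1"
    and \<Psi>: "\<forall>t\<ge>1. \<Psi> t = (\<Sum>k=1..t. \<mu> ^ k)"
    and \<alpha>: "\<forall>t\<ge>1. \<alpha> t = \<alpha>0 * sqrt (\<Psi> t / real t)"
    and \<gamma>: "\<forall>t\<ge>1. \<gamma> t = \<gamma>0 / \<alpha> t"
    and s: "\<forall>t\<ge>1. s t = s0 * \<mu> ^ t"
    and z1: "\<forall>i. z1 i \<in> X"
    and run: "\<forall>a\<in>space M. algorithm_run X W m df g dg cmp \<alpha> \<gamma> s z1 (\<lambda>j t. \<xi> j t a)
        (\<lambda>i t. z i t a) (\<lambda>i t. zhat i t a) (\<lambda>i t. x i t a) (\<lambda>i t. v i t a) (\<lambda>i t. \<omega> i t a)"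
  shows "(\<forall>T\<ge>1. integrable M (\<lambda>a. net_reg X m df g (\<lambda>i t. x i t a) T)) \<and>
    (\<forall>T\<ge>1. integrable M (\<lambda>a. net_ccv m g (\<lambda>i t. x i t a) T)) \<and>
    (\<exists>c. \<forall>T\<ge>1. (LINT a|M. net_reg X m df g (\<lambda>i t. x i t a) T) \<le> c * sqrt (real T)) \<and>
    (\<lambda>T. LINT a|M. net_ccv m g (\<lambda>i t. x i t a) T) \<in> O(\<lambda>T. real T powr (3 / 4)) \<and>
    ((\<exists>xs\<in>X. \<exists>\<sigma>>0. \<forall>t\<ge>1. \<forall>i. \<forall>k<m i. g i t xs k \<le> - \<sigma>) \<longrightarrow>
      (\<lambda>T. LINT a|M. net_ccv m g (\<lambda>i t. x i t a) T) \<in> O(\<lambda>T. sqrt (real T)))"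
proof -
  \<comment> \<open>For \<open>G2 = 0\<close> the quotient \<open>1 / (4 * G2\<^sup>2)\<close> would
    be 0 by convention, contradicting the positivity of \<gamma>0 below it.\<close>
  have "G2 \<noteq> 0" using params by auto
  then have \<gamma>0_G2: "\<gamma>0 * G2\<^sup>2 \<le> 1 / 4" using params(3) by (simp add: field_simps)
  have \<Psi>_pos: "\<mu> \<le> \<Psi> t" if "t \<ge> 1" for t
  proof -
    have "\<mu> ^ 1 \<le> (\<Sum>k=1..t. \<mu> ^ k)" using params that by (intro member_le_sum) auto
    then show ?thesis using \<Psi> that by simp
  qed
  have \<Psi>_le: "\<Psi> t \<le> 1 / (1 - \<mu>)" if "t \<ge> 1" for t
    using sum_power_le[of \<mu> t] \<Psi> that params by simp
  have \<alpha>_pos: "0 < \<alpha> t" if "t \<ge> 1" for t using \<Psi>_pos[OF that] \<alpha> that params by simp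
  have \<alpha>_mono: "\<alpha> (Suc t) \<le> \<alpha> t" if t: "t \<ge> 1" for t
  proof -
    \<comment> \<open>The quotient of \<open>\<Psi> t\<close> by \<open>t\<close> is the mean of the
      first \<open>t\<close> terms of a decreasing sequence, and appending a smaller term lowers a
      mean.\<close>
    have "real t * \<mu> ^ Suc t = (\<Sum>k=1..t. \<mu> ^ Suc t)" by simp
    also have "\<dots> \<le> (\<Sum>k=1..t. \<mu> ^ k)" using params by (intro sum_mono power_decreasing) auto
    finally have "real t * \<mu> ^ Suc t \<le> \<Psi> t" using \<Psi> t by simp
    moreover have "\<Psi> (Suc t) = \<Psi> t + \<mu> ^ Suc t" using \<Psi> t by simp
    ultimately have "\<Psi> (Suc t) / real (Suc t) \<le> \<Psi> t / real t" using t by (simp add: field_simps)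
    then show ?thesis using \<alpha> t params by simp
  qed
  have \<alpha>_eq: "\<alpha> t = \<alpha>0 * sqrt (\<Psi> t) / sqrt (real t)" if "t \<ge> 1" for t
    using \<alpha> that by (simp add: real_sqrt_divide)
  define c1 where "c1 = \<alpha>0 * sqrt \<mu>"
  define c2 where "c2 = \<alpha>0 * sqrt (1 / (1 - \<mu>))"
  have c: "0 < c1" "0 < c2" using params by (auto simp: c1_def c2_def)
  have lower: "c1 / sqrt (real t) \<le> \<alpha> t" if "t \<ge> 1" for t
    unfolding \<alpha>_eq[OF that] c1_def using \<Psi>_pos[OF that] params
    by (intro divide_right_mono mult_left_mono real_sqrt_le_mono) auto
  have upper: "\<alpha> t \<le> c2 / sqrt (real t)" if "t \<ge> 1" for t
    unfolding \<alpha>_eq[OF that] c2_def using \<Psi>_le[OF that] params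
    by (intro divide_right_mono mult_left_mono real_sqrt_le_mono) auto
  have s_eq: "s t = s0 * \<mu> ^ t" if "t \<ge> 1" for t using s that by simp
  interpret prob_space M by (rule M)
  interpret K: prob_space K by (rule K)
  interpret random_run X E W m df g dg cmp z1 R G1 G2 L w \<gamma>0 B \<alpha> \<gamma> s M K \<xi> z zhat x \<omega> v C d
  proof unfold_locales
    show "norm (df i t x) \<le> G1" if "t \<ge> 1" "x \<in> X" for i t x using df that by blast
    show "g i t y k \<ge> g i t x k + dg i t x k \<bullet> (y - x)" if "t \<ge> 1" "x \<in> X" "k < m i" "y \<in> X" for i t x k y
      using dg that by blast
    show "op_norm (m i) (dg i t x) \<le> G2" if "t \<ge> 1" "x \<in> X" for i t x using dg that by blast
    show "w \<le> W t $ i $ j" if "t \<ge> 1" "(j, i) \<in> E t \<or> i = j" for t i j using W_weights that by presburger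
    show "0 < s t" if "t \<ge> 1" for t using s that params by simp
    show "convex X" "closed X" by (rule X)+
    show "norm x \<le> R" if "x \<in> X" for x using X(3) that by blast
    show "feasible X m g T \<noteq> {}" if "T \<ge> 1" for T using feasible that by blast
    show "norm (df i t x - df i t y) \<le> L * norm (x - y)" if "t \<ge> 1" "x \<in> X" "y \<in> X" for i t x y
      using df_Lipschitz that by blast
    show "doubly_stochastic (W t)" if "t \<ge> 1" for t using W_stochastic that by blast
    show "strongly_connected (\<Union>l\<in>{0..B - 1}. E (t + l))" if "t \<ge> 1" for t using B that by blast
    show "\<gamma> t = \<gamma>0 / \<alpha> t" if "t \<ge> 1" for t using \<gamma> that by blast
    show "z1 i \<in> X" for i using z1 by blast
    show "(\<lambda>x. dg i t x k) \<in> borel_measurable (restrict_space borel X)" if "t \<ge> 1" "k < m i" for i t k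
      using dg_measurable that by blast
    show "(\<integral>\<^sup>+ r. ennreal ((lp_norm d (cmp u r - u))\<^sup>2) \<partial>K) \<le> ennreal C" for u
      using cmp_error by blast
    show "algorithm_run X W m df g dg cmp \<alpha> \<gamma> s z1 (\<lambda>j t. \<xi> j t a)
        (\<lambda>i t. z i t a) (\<lambda>i t. zhat i t a) (\<lambda>i t. x i t a) (\<lambda>i t. v i t a) (\<lambda>i t. \<omega> i t a)" if "a \<in> space M" for a
      using run that by blast
  qed (fact w B(1) params(2) \<alpha>_pos \<alpha>_mono \<gamma>0_G2 cmp_measurable d C fresh)+
  note rate_params = c \<open>0 < s0\<close> \<open>0 < \<mu>\<close> \<open>\<mu> < 1\<close> lower upper s_eq
  \<comment> \<open>The upper bound becomes a bound on the absolute value because cumulative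
    violation is nonnegative. Regret can be negative, so its rate stays a one-sided
    inequality.\<close>
  have bigo: "(\<lambda>T. expectation (ccv T)) \<in> O(h)"
    if "\<exists>c. \<forall>T\<ge>1. expectation (ccv T) \<le> c * h T" and h: "\<And>T. 0 \<le> h T" for h :: "nat \<Rightarrow> real"
  proof -
    from that(1) obtain c where c: "\<And>T. T \<ge> 1 \<Longrightarrow> expectation (ccv T) \<le> c * h T" by auto
    have "0 \<le> expectation (ccv T)" for T by (intro Bochner_Integration.integral_nonneg ccv_nonneg)
    with c h show ?thesis by (intro bigoI[of _ c] eventually_sequentiallyI[of 1]) auto
  qed
  have "(\<lambda>T. expectation (ccv T)) \<in> O(\<lambda>T. sqrt (real T))"
    if "xs \<in> X" "0 < \<sigma>" "\<forall>t\<ge>1. \<forall>i. \<forall>k<m i. g i t xs k \<le> - \<sigma>" for xs \<sigma>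
    using that by (intro bigo ccv_rate_Slater[OF rate_params, of xs \<sigma>]) auto
  moreover have "(\<lambda>T. expectation (ccv T)) \<in> O(\<lambda>T. real T powr (3 / 4))"
    by (intro bigo ccv_rate[OF rate_params]) auto
  moreover have "\<exists>c. \<forall>T\<ge>1. expectation (reg T) \<le> c * sqrt (real T)"
    by (rule regret_rate[OF rate_params])
  ultimately show ?thesis using integrable_reg integrable_ccv by blast
qed

end
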